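(* Let $E$ be a Banach space, $P\in C^1(E,E)$, $Q\in C^0(E\times[0,1],E)$, and assume that for any $R>0$ there exists $L(R)>0$ such that $\|Q(\xi_1,\varepsilon)-Q(\xi_2,\varepsilon)\|\le L(R)\|\xi_1-\xi_2\|$ whenever $\xi_1,\xi_2\in B_E(0,R)$ and $\varepsilon\in[0,1]$. Let $h_0\in\mathbb{R}^k$, $r_0>0$ and $S\in C^1(B_{\mathbb{R}^k}(h_0,r_0),E)$ be such that $P(\xi)=\xi$ for any $\xi\in\{S(h):h\in B_{\mathbb{R}^k}(h_0,r_0)\}$, and assume $\dim S'(h_0)\mathbb{R}^k=k$. Let $E_{1,h}=S'(h)\mathbb{R}^k$ and let $E_{2,h}$ be any subspace of $E$ such that $E=E_{1,h}\oplus E_{2,h}$. Assume that both the projectors $\pi_{1,h}$ of $E$ onto $E_{1,h}$ along $E_{2,h}$ and $\pi_{2,h}$ of $E$ onto $E_{2,h}$ along $E_{1,h}$ are continuous in $h\in B_{\mathbb{R}^k}(h_0,r_0)$. Put $\xi_0=S(h_0)$ and assume that $\pi_{2,h_0}(P'(\xi_0)-I)\pi_{2,h_0}$ is invertible on $E_{2,h_0}$. Then there exist $0<r_2<r_1<r_0$, a function $H:B_E(\xi_0,r_1)\to\mathbb{R}^k$ with $H(\xi)\to h_0$ as $\xi\to\xi_0$, and a function $\beta:B_{\mathbb{R}^k}(h_0,r_1)\times[0,r_1]\to E$ with $\beta(\cdot,\varepsilon)\in C^0(B_{\mathbb{R}^k}(h_0,r_1),E)$, with $\|\beta(h,\varepsilon)\|\le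 M\varepsilon$ for some $M>0$, any $h\in B_{\mathbb{R}^k}(h_0,r_1)$ and any $\varepsilon\in[0,r_1]$, with $\beta(h,\varepsilon)\in E_{2,h}$, and with $$\frac{\beta(h,\varepsilon)}{\varepsilon}\to-\left(\pi_{2,h}(P'(S(h))-I)\pi_{2,h}\right)^{-1}\pi_{2,h}Q(S(h),0)\quad\text{as }\varepsilon\to0,$$ uniformly in $h\in B_{\mathbb{R}^k}(h_0,r_1)$, such that the following properties hold: 1) if $(\xi,\varepsilon)\in B_E(\xi_0,r_2)\times[0,r_2]$ is a solution of $$P(\xi)-\xi+\varepsilon Q(\xi,\varepsilon)=0,\qquad( * )$$ then $(h,\varepsilon)$, where $h=H(\xi)$, is a solution of $$\left(S'(h)\right)^{-1}\pi_{1,h}\left[P(\beta(h,\varepsilon)+S(h))-(\beta(h,\varepsilon)+S(h))+\varepsilon Q(\beta(h,\varepsilon)+S(h),\varepsilon)\right]=0;\qquad( ** )$$ 2) if $(h,\varepsilon)\in B_{\mathbb{R}^k}(h_0,r_1)\times[0,r_1]$ solves $( ** )$, then $(\xi,\varepsilon)$ with $\xi=\beta(h,\varepsilon)+S(h)$ solves $( * )$.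
   Context: $B_X(c,r)$ denotes the ball in the normed space $X$ centered at $c$ with radius $r>0$. $I$ is the identity operator and $P'$, $S'$ denote (Fréchet) derivatives. $(S'(h))^{-1}$ denotes the inverse of $S'(h):\mathbb{R}^k\to E_{1,h}$, which exists for $h$ sufficiently close to $h_0$ by the assumptions. $\left(\pi_{2,h}(P'(S(h))-I)\pi_{2,h}\right)^{-1}$ denotes the inverse of this operator regarded as an operator from $E_{2,h}$ to $E_{2,h}$ (it exists for $h$ sufficiently close to $h_0$). *)

theory Defs
  imports "HOL-Analysis.Analysis"
begin

definition direct_sum_decomp :: "'a::real_vector set \<Rightarrow> 'a set \<Rightarrow> bool" where
  "direct_sum_decomp V W \<longleftrightarrow>
     subspace V \<and> subspace W \<and> V \<inter> W = {0} \<and> (\<forall>x. \<exists>v\<in>V. \<exists>w\<in>W. x = v + w)"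

text \<open>
  The projector onto \<open>V\<close> along \<open>W\<close>. When \<open>V\<close> and \<open>W\<close> are complementary, this condition
  determines \<open>p\<close> uniquely. The projectors are taken as bounded operators, so that their
  continuous dependence on a parameter refers to the operator norm.
\<close>

definition projector_onto_along ::
    "('a::real_normed_vector \<Rightarrow>\<^sub>L 'a) \<Rightarrow> 'a set \<Rightarrow> 'a set \<Rightarrow> bool" where
  "projector_onto_along p V W \<longleftrightarrow> (\<forall>v\<in>V. \<forall>w\<in>W. blinfun_apply p (v + w) = v)"

text \<open>
  Invertibility of an operator on a subspace is bijectivity there. For a bounded operator and a
  closed subspace of a Banach space, boundedness of the inverse is then automatic (open mapping
  theorem).
\<close>

definition invertible_on :: "('a::real_normed_vector \<Rightarrow>\<^sub>L 'a) \<Rightarrow> 'a set \<Rightarrow> bool" where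
  "invertible_on T V \<longleftrightarrow> bij_betw (blinfun_apply T) V V"

definition inverse_on :: "('a::real_normed_vector \<Rightarrow>\<^sub>L 'a) \<Rightarrow> 'a set \<Rightarrow> 'a \<Rightarrow> 'a" where
  "inverse_on T V = inv_into V (blinfun_apply T)"

end

theory Submission
  imports Defs
begin

text \<open>
  Differentiating \<open>P (S h) = S h\<close> shows that \<open>P' (S h) - I\<close> vanishes on \<open>E1 h\<close>, so
  \<open>\<pi>1 h + \<pi>2 h (P' (S h) - I)\<close> is an operator on all of \<open>E\<close> that is bijective exactly when
  \<open>\<pi>2 h (P' (S h) - I) \<pi>2 h\<close> is so on \<open>E2 h\<close>. At \<open>h0\<close> it has a bounded inverse, by the open mapping
  theorem, and a simplified Newton iteration with this one fixed inverse, uniform in \<open>h\<close> and \<open>\<epsilon>\<close>,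
  yields \<open>\<beta> h \<epsilon>\<close> as the only small zero of
  \<open>\<pi>1 h x + \<pi>2 h (P (x + S h) - (x + S h) + \<epsilon> Q (x + S h, \<epsilon>))\<close>.
  For \<open>\<xi>\<close> near \<open>\<xi>0\<close> one picks \<open>h = H \<xi>\<close> near \<open>h0\<close> with \<open>\<pi>1 h (\<xi> - S h) = 0\<close>; if \<open>\<xi>\<close> solves the
  equation, uniqueness forces \<open>\<xi> - S h = \<beta> h \<epsilon>\<close>.
\<close>

section \<open>Bounded operators\<close>

text \<open>The open mapping theorem in quantitative form. By Baire, the closure of the image of
  some ball has an interior point, and convexity and symmetry move it to 0. Every \<open>y\<close>
  then has a controlled approximate preimage with half of \<open>y\<close> as error, and iterating
  sums the corrections to an exact preimage.\<close>

lemma surj_blinfun_bounded_preimage: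
  fixes f :: "'a::banach \<Rightarrow>\<^sub>L 'b::banach"
  assumes surj: "surj (blinfun_apply f)"
  obtains c where "c > 0" "\<And>y. \<exists>x. f x = y \<and> norm x \<le> c * norm y"
proof -
  define K where "K n = closure (f ` cball 0 (real n))" for n
  have "\<exists>n. interior (K n) \<noteq> {}"
  proof (rule ccontr)
    assume "\<nexists>n. interior (K n) \<noteq> {}"
    then have emp: "interior (K n) = {}" for n by auto
    have "euclidean interior_of \<Union>(range K) = {}"
    proof (rule Baire_category_alt)
      show "completely_metrizable_space (euclidean :: 'b topology) \<or>
         locally_compact_space (euclidean :: 'b topology) \<and> regular_space (euclidean :: 'b topology)"
        by (simp add: completely_metrizable_space_euclidean)
    qed (use emp in \<open>auto simp: K_def\<close>)
    moreover have "\<Union>(range K) = UNIV"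
    proof -
      have "y \<in> \<Union>(range K)" for y
      proof -
        obtain x where x: "y = f x" using surj by (metis surjD)
        obtain n where "norm x \<le> real n" using real_arch_simple by blast
        then have "y \<in> f ` cball 0 (real n)" using x by auto
        then have "y \<in> K n" unfolding K_def by (rule subsetD[OF closure_subset])
        then show ?thesis by (rule UN_I[OF UNIV_I])
      qed
      then show ?thesis by auto
    qed
    ultimately show False by simp
  qed
  then obtain n y0 where "y0 \<in> interior (K n)" by auto
  then obtain e where e: "e > 0" "ball y0 e \<subseteq> K n" by (meson mem_interior)
  have conv: "convex (K n)" unfolding K_def
    by (intro convex_closure convex_linear_image blinfun.bounded_linear_right[THEN bounded_linear.linear])
       simp
  have sym: "- z \<in> K n" if "z \<in> K n" for z
  proof -
    have "uminus ` f ` cball 0 (real n) = f ` cball 0 (real n)"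
    proof -
      have "uminus ` f ` cball 0 (real n) = f ` uminus ` cball 0 (real n)"
        by (simp add: image_image blinfun.minus_right)
      also have "uminus ` cball (0::'a) (real n) = cball 0 (real n)"
        by (auto intro!: image_eqI[where x="- x" for x])
      finally show ?thesis .
    qed
    then have "uminus ` K n = K n" unfolding K_def
      using closure_scaleR[of "-1" "f ` cball 0 (real n)"] by simp
    then show ?thesis using that by blast
  qed
  \<comment> \<open>\<open>z\<close> is the midpoint of \<open>y0 + z\<close> and
    \<open>- (y0 - z)\<close>.\<close>
  have ball0: "z \<in> K n" if "norm z < e" for z
  proof -
    have "y0 + z \<in> K n" "y0 - z \<in> K n" using e that by (auto simp: dist_norm subset_iff)
    then have "(1/2) *\<^sub>R (y0 + z) + (1/2) *\<^sub>R (- (y0 - z)) \<in> K n"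
      by (intro convexD[OF conv] sym) auto
    moreover have "(1/2) *\<^sub>R (y0 + z) + (1/2) *\<^sub>R (- (y0 - z)) = (1/2 + 1/2) *\<^sub>R z"
      unfolding scaleR_add_left by (simp add: algebra_simps)
    ultimately show ?thesis by simp
  qed
  \<comment> \<open>A vector scaled to norm \<open>e / 2\<close> has an approximate preimage of norm
    at most \<open>n\<close>; undoing the scaling by \<open>t = e / (2 * norm y)\<close> gives the
    factor \<open>2 * n / e\<close> and turns the tolerance \<open>e / 4\<close> into
    \<open>norm y / 2\<close>.\<close>
  define c where "c = 2 * real n / e"
  have c0: "c \<ge> 0" using e by (simp add: c_def)
  have "\<exists>x. norm x \<le> c * norm y \<and> norm (y - f x) \<le> norm y / 2" for y
  proof (cases "y = 0")
    case True
    then show ?thesis by (intro exI[of _ 0]) (simp add: blinfun.zero_right)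
  next
    case False
    define t where "t = e / (2 * norm y)"
    have t: "t > 0" using e False by (simp add: t_def)
    have "norm (t *\<^sub>R y) < e" using e False by (simp add: t_def)
    then have "t *\<^sub>R y \<in> closure (f ` cball 0 (real n))" using ball0 unfolding K_def by blast
    moreover have "e / 4 > 0" using e by simp
    ultimately obtain x0 where x0: "norm x0 \<le> real n" "dist (f x0) (t *\<^sub>R y) < e / 4"
      unfolding closure_approachable by fastforce
    have "norm (y - f (x0 /\<^sub>R t)) = norm ((t *\<^sub>R y - f x0) /\<^sub>R t)"
      using t by (simp add: blinfun.scaleR_right scaleR_diff_right)
    also have "\<dots> = norm (t *\<^sub>R y - f x0) / t" using t by (simp add: divide_inverse mult.commute)
    also have "\<dots> \<le> (e / 4) / t"
      using x0 t by (intro divide_right_mono) (auto simp: dist_norm norm_minus_commute)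
    also have "\<dots> = norm y / 2" using e False by (simp add: t_def)
    finally have "norm (y - f (x0 /\<^sub>R t)) \<le> norm y / 2" .
    moreover have "norm (x0 /\<^sub>R t) \<le> c * norm y"
    proof -
      have "norm (x0 /\<^sub>R t) = norm x0 / t" using t by (simp add: divide_inverse mult.commute)
      also have "\<dots> \<le> real n / t" using x0 t by (intro divide_right_mono) auto
      also have "\<dots> = c * norm y" using e False by (simp add: t_def c_def)
      finally show ?thesis .
    qed
    ultimately show ?thesis by blast
  qed
  then obtain g where g: "\<And>y. norm (g y) \<le> c * norm y" "\<And>y. norm (y - f (g y)) \<le> norm y / 2"
    by metis
  \<comment> \<open>The residual \<open>r k\<close> halves at each correction, so the corrections
    form a geometric series bounded by \<open>2 * c * norm y\<close>, and their images telescope to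
    \<open>y\<close>. The extra 1 keeps the constant positive when \<open>c = 0\<close>.\<close>
  have pre: "\<exists>x. f x = y \<and> norm x \<le> (2 * c + 1) * norm y" for y
  proof -
    define r where "r k = ((\<lambda>z. z - f (g z)) ^^ k) y" for k
    have r_Suc: "r (Suc k) = r k - f (g (r k))" for k by (simp add: r_def)
    have r_le: "norm (r k) \<le> norm y * (1/2) ^ k" for k
    proof (induction k)
      case (Suc k)
      then show ?case using g(2)[of "r k"] by (simp add: r_Suc)
    qed (simp add: r_def)
    have gr: "norm (g (r k)) \<le> (c * norm y) * (1/2) ^ k" for k
      using g(1)[of "r k"] mult_left_mono[OF r_le[of k] c0] by (simp add: mult.assoc)
    have sg: "summable (\<lambda>k. (c * norm y) * (1/2::real) ^ k)"
      by (intro summable_mult summable_geometric) simp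
    have sn: "summable (\<lambda>k. norm (g (r k)))"
      by (rule summable_comparison_test[OF _ sg]) (use gr in auto)
    then have s: "summable (\<lambda>k. g (r k))" by (rule summable_norm_cancel)
    have "norm (\<Sum>k. g (r k)) \<le> (\<Sum>k. norm (g (r k)))" by (rule summable_norm[OF sn])
    also have "\<dots> \<le> (\<Sum>k. (c * norm y) * (1/2) ^ k)" by (rule suminf_le[OF gr sn sg])
    also have "\<dots> = 2 * c * norm y" by (subst suminf_mult) (simp_all add: suminf_geometric)
    finally have nx: "norm (\<Sum>k. g (r k)) \<le> 2 * c * norm y" .
    have "(\<lambda>k. r k - r (Suc k)) sums (r 0 - 0)"
    proof (rule telescope_sums')
      show "r \<longlonglongrightarrow> 0"
      proof (rule Lim_null_comparison)
        show "\<forall>\<^sub>F k in sequentially. norm (r k) \<le> norm y * (1/2) ^ k" using r_le by auto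
        show "(\<lambda>k. norm y * (1/2) ^ k) \<longlonglongrightarrow> 0"
          by (intro tendsto_mult_right_zero LIMSEQ_realpow_zero) auto
      qed
    qed
    then have "(\<lambda>k. f (g (r k))) sums y" by (simp add: r_Suc) (simp add: r_def)
    moreover have "(\<lambda>k. f (g (r k))) sums f (\<Sum>k. g (r k))"
      by (rule bounded_linear.sums[OF blinfun.bounded_linear_right summable_sums[OF s]])
    ultimately have "f (\<Sum>k. g (r k)) = y" by (rule sums_unique2[symmetric])
    moreover have "2 * c * norm y \<le> (2 * c + 1) * norm y" by (simp add: algebra_simps)
    ultimately show ?thesis using nx by fastforce
  qed
  show thesis
    by (rule that[of "2 * c + 1"]) (use c0 pre in auto)
qed

text \<open>The preimage provided by the open mapping theorem is the only one, so its bound is a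
  bound for the inverse.\<close>

lemma bij_blinfun_inverse:
  fixes f :: "'a::banach \<Rightarrow>\<^sub>L 'b::banach"
  assumes bij: "bij (blinfun_apply f)"
  obtains g where "\<And>x. blinfun_apply g (f x) = x" "\<And>y. f (blinfun_apply g y) = y"
proof -
  obtain c where c: "\<And>y. \<exists>x. f x = y \<and> norm x \<le> c * norm y"
    using surj_blinfun_bounded_preimage[OF bij_is_surj[OF bij]] by metis
  have fg: "f (inv f y) = y" for y by (rule surj_f_inv_f[OF bij_is_surj[OF bij]])
  have gf: "inv f (f x) = x" for x by (rule inv_f_f[OF bij_is_inj[OF bij]])
  have "bounded_linear (inv f)"
  proof (rule bounded_linear_intro[where K = c])
    show "inv f (x + y) = inv f x + inv f y" for x y
      by (metis fg gf blinfun.add_right)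
    show "inv f (a *\<^sub>R x) = a *\<^sub>R inv f x" for a x
      by (metis fg gf blinfun.scaleR_right)
    show "norm (inv f x) \<le> norm x * c" for x
      using c[of x] gf by (auto simp: mult.commute)
  qed
  then show thesis
    by (intro that[of "Blinfun (inv f)"]) (simp_all add: bounded_linear_Blinfun_apply fg gf)
qed

section \<open>Lipschitz perturbations of an invertible operator\<close>

text \<open>\<open>A\<close> expands by at least \<open>1 / b\<close>, and the perturbation uses up
  at most half of that. The resulting inequality measures the distance of two points by their
  residuals.\<close>

lemma perturbed_inverse_lower_bound:
  fixes A :: "'a::real_normed_vector \<Rightarrow>\<^sub>L 'b::real_normed_vector"
  assumes BA: "\<And>x. blinfun_apply B (A x) = x" and b: "b > 0" "norm B \<le> b"
    and G: "norm (G x - G y - A (x - y)) \<le> norm (x - y) / (2 * b)"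
  shows "norm (x - y) \<le> 2 * b * norm (G x - G y)"
proof -
  have "norm (x - y) = norm (B (A (x - y)))" by (simp add: BA)
  also have "\<dots> \<le> b * norm (A (x - y))"
    by (meson b(2) mult_right_mono norm_blinfun norm_ge_zero order_trans)
  also have "norm (A (x - y)) \<le> norm (G x - G y) + norm (x - y) / (2 * b)"
    using G norm_triangle_sub[of "A (x - y)" "G x - G y"] by (simp add: norm_minus_commute)
  then have "b * norm (A (x - y)) \<le> b * norm (G x - G y) + norm (x - y) / 2"
    using b by (simp add: field_simps)
  finally show ?thesis by simp
qed

text \<open>The simplified Newton map \<open>x - B (G x)\<close> contracts by 1/2, since
  \<open>B A\<close> is the identity and \<open>G - A\<close> has Lipschitz constant
  \<open>1 / (2 * b)\<close>. It moves 0 by at most half of \<open>\<rho>\<close>, so it maps the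
  ball into itself; a fixed point is a zero of \<open>G\<close> because \<open>B\<close> is
  injective.\<close>

lemma perturbed_inverse_zero:
  fixes A :: "'a::banach \<Rightarrow>\<^sub>L 'b::real_normed_vector"
  assumes BA: "\<And>x. blinfun_apply B (A x) = x" and AB: "\<And>y. A (blinfun_apply B y) = y"
    and b: "b > 0" "norm B \<le> b"
    and G: "\<And>x y. x \<in> cball 0 \<rho> \<Longrightarrow> y \<in> cball 0 \<rho> \<Longrightarrow>
      norm (G x - G y - A (x - y)) \<le> norm (x - y) / (2 * b)"
    and G0: "2 * b * norm (G 0) \<le> \<rho>"
  obtains x where "x \<in> cball 0 \<rho>" "G x = 0"
proof -
  define \<Phi> where "\<Phi> x = x - B (G x)" for x
  have nB: "norm (B y) \<le> b * norm y" for y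
    by (meson b(2) mult_right_mono norm_blinfun norm_ge_zero order_trans)
  have \<rho>: "\<rho> \<ge> 0" using G0 b by (meson mult_nonneg_nonneg less_imp_le norm_ge_zero order_trans zero_le_numeral)
  have lip: "norm (\<Phi> x - \<Phi> y) \<le> (1/2) * norm (x - y)" if "x \<in> cball 0 \<rho>" "y \<in> cball 0 \<rho>" for x y
  proof -
    have "\<Phi> x - \<Phi> y = - B (G x - G y - A (x - y))"
      by (simp add: \<Phi>_def blinfun.diff_right BA)
    then have "norm (\<Phi> x - \<Phi> y) \<le> b * norm (G x - G y - A (x - y))" using nB by simp
    also have "\<dots> \<le> b * (norm (x - y) / (2 * b))" using G[OF that] b by (intro mult_left_mono) auto
    finally show ?thesis using b by simp
  qed
  have \<Phi>0: "norm (\<Phi> 0) \<le> \<rho> / 2" using nB[of "G 0"] G0 by (simp add: \<Phi>_def)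
  have "\<exists>!x\<in>cball 0 \<rho>. \<Phi> x = x"
  proof (rule Banach_fix)
    show "complete (cball (0::'a) \<rho>)" by (simp add: complete_eq_closed)
    show "cball (0::'a) \<rho> \<noteq> {}" using \<rho> by simp
    show "\<Phi> ` cball 0 \<rho> \<subseteq> cball 0 \<rho>"
    proof safe
      fix x :: 'a assume x: "x \<in> cball 0 \<rho>"
      have "norm (\<Phi> x) \<le> norm (\<Phi> x - \<Phi> 0) + norm (\<Phi> 0)" by (metis diff_add_cancel norm_triangle_ineq)
      also have "\<dots> \<le> \<rho> / 2 + \<rho> / 2" using lip[OF x, of 0] x \<rho> \<Phi>0 by (intro add_mono) auto
      finally show "\<Phi> x \<in> cball 0 \<rho>" by simp
    qed
    show "dist (\<Phi> x) (\<Phi> y) \<le> 1/2 * dist x y" if "x \<in> cball 0 \<rho>" "y \<in> cball 0 \<rho>" for x y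
      using lip[OF that] by (simp add: dist_norm)
  qed auto
  then obtain x where x: "x \<in> cball 0 \<rho>" "\<Phi> x = x" by auto
  then have "B (G x) = 0" by (simp add: \<Phi>_def)
  then have "G x = 0" by (metis AB blinfun.zero_right)
  with x show thesis by (intro that)
qed

section \<open>Uniform linearisation, and injective maps from Euclidean space\<close>

text \<open>In infinite dimension \<open>x + v\<close> ranges over a set that is not compact, so
  uniform continuity of \<open>f'\<close> on \<open>K\<close> alone is too weak. A Lebesgue number
  for a cover of \<open>K\<close> by open sets on which \<open>f'\<close> varies little controls
  \<open>f'\<close> on whole balls around points of \<open>K\<close>, and the mean value inequality
  finishes.\<close>

lemma compact_uniformly_differentiable:
  fixes f :: "'a::real_normed_vector \<Rightarrow> 'b::real_normed_vector" and f' :: "'a \<Rightarrow> 'a \<Rightarrow>\<^sub>L 'b"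
  assumes der: "\<And>x. (f has_derivative f' x) (at x)" and cont: "continuous_on UNIV f'"
    and K: "compact K" and e: "e > 0"
  obtains d where "d > 0"
    "\<And>x v. x \<in> K \<Longrightarrow> norm v < d \<Longrightarrow> norm (f (x + v) - f x - f' x v) \<le> e * norm v"
proof -
  obtain d where d: "d > 0"
    "\<And>x. x \<in> K \<Longrightarrow> \<exists>G \<in> range (\<lambda>y. f' -` ball (f' y) (e/2)). ball x d \<subseteq> G"
  proof (rule Heine_Borel_lemma[OF K])
    show "K \<subseteq> \<Union>(range (\<lambda>y. f' -` ball (f' y) (e/2)))"
    proof
      fix x
      have "x \<in> f' -` ball (f' x) (e/2)" using e by simp
      then show "x \<in> \<Union>(range (\<lambda>y. f' -` ball (f' y) (e/2)))" by blast
    qed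
    show "open G" if "G \<in> range (\<lambda>y. f' -` ball (f' y) (e/2))" for G
      using that cont by (auto intro: open_vimage)
  qed blast
  have "norm (f (x + v) - f x - f' x v) \<le> e * norm v" if x: "x \<in> K" and v: "norm v < d" for x v
  proof -
    obtain y where y: "ball x d \<subseteq> f' -` ball (f' y) (e/2)" using d(2)[OF x] by auto
    have close: "norm (f' z - f' x) \<le> e" if "z \<in> ball x d" for z
    proof -
      have "x \<in> ball x d" using d(1) by simp
      then have "dist (f' y) (f' z) < e/2" "dist (f' y) (f' x) < e/2"
        using subsetD[OF y that] subsetD[OF y] by auto
      then have "dist (f' z) (f' x) < e" by (metis dist_commute dist_triangle_half_l)
      then show ?thesis by (simp add: dist_norm)
    qed
    have "norm (f (x + v) - f x - f' x (x + v - x)) \<le> norm (x + v - x) * e"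
    proof (rule differentiable_bound_linearization[where S = "ball x d" and f' = "\<lambda>x. blinfun_apply (f' x)"])
      show "x + t *\<^sub>R (x + v - x) \<in> ball x d" if "t \<in> {0..1}" for t
        using that v mult_left_le_one_le[of "norm v" t] by (simp add: dist_norm)
      have "blinfun_apply (f' z) - f' x = f' z - f' x" for z
        by (simp add: fun_eq_iff blinfun.diff_left)
      then show "onorm (blinfun_apply (f' z) - f' x) \<le> e" if "z \<in> ball x d" for z
        using close[OF that] by (simp add: norm_blinfun.rep_eq)
    qed (use der d(1) in \<open>auto intro: has_derivative_at_withinI\<close>)
    then show ?thesis by (simp add: mult.commute)
  qed
  with d(1) show thesis by (rule that)
qed

text \<open>If \<open>v\<close> spans part of the kernel, the hyperplane orthogonal to
  \<open>v\<close> already has the full range as image, which costs one dimension.\<close>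

lemma inj_if_dim_range_eq:
  fixes f :: "'a::euclidean_space \<Rightarrow> 'b::real_vector"
  assumes f: "linear f" and d: "dim (range f) = DIM('a)"
  shows "inj f"
proof (rule ccontr)
  assume "\<not> inj f"
  then obtain v where v: "v \<noteq> 0" "f v = 0" using linear_injective_0[OF f] by blast
  have "range f \<subseteq> f ` {x. v \<bullet> x = 0}"
  proof
    fix y assume "y \<in> range f"
    then obtain x where x: "y = f x" by auto
    define c where "c = (v \<bullet> x) / (v \<bullet> v)"
    have "f (x - c *\<^sub>R v) = y"
      using x v by (simp add: linear_diff[OF f] linear_scale[OF f])
    moreover have "v \<bullet> (x - c *\<^sub>R v) = 0" using v by (simp add: c_def inner_diff_right)
    ultimately show "y \<in> f ` {x. v \<bullet> x = 0}" by (metis (mono_tags, lifting) image_eqI mem_Collect_eq)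
  qed
  then have "range f = f ` {x. v \<bullet> x = 0}" by auto
  then have "DIM('a) \<le> dim {x. v \<bullet> x = 0}" using d eucl.dim_image_le[OF f] by metis
  moreover have "dim {x. v \<bullet> x = 0} = DIM('a) - 1" using v by (intro dim_hyperplane)
  ultimately show False using DIM_positive[where 'a='a] by linarith
qed

text \<open>Compactness of the unit sphere turns injectivity into an estimate that survives small
  perturbations.\<close>

lemma inj_blinfun_bounded_below:
  fixes f :: "'a::euclidean_space \<Rightarrow>\<^sub>L 'b::real_normed_vector"
  assumes inj: "inj (blinfun_apply f)"
  obtains c where "c > 0" "\<And>x. c * norm x \<le> norm (f x)"
proof -
  have "compact (sphere (0::'a) 1)" "sphere (0::'a) 1 \<noteq> {}" by auto
  moreover have "continuous_on (sphere (0::'a) 1) (\<lambda>x. norm (f x))" by (intro continuous_intros)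
  ultimately obtain u where u: "u \<in> sphere 0 1" "\<And>x. x \<in> sphere 0 1 \<Longrightarrow> norm (f u) \<le> norm (f x)"
    by (meson continuous_attains_inf)
  have "f u \<noteq> 0" using u(1) inj by (metis blinfun.zero_right injD dist_0_norm mem_sphere norm_zero zero_neq_one)
  show thesis
  proof (rule that[of "norm (f u)"])
    show "norm (f u) * norm x \<le> norm (f x)" for x
    proof (cases "x = 0")
      case False
      then have "norm (f u) \<le> norm (f (x /\<^sub>R norm x))" by (intro u(2)) simp
      then show ?thesis using False by (simp add: blinfun.scaleR_right field_simps)
    qed simp
  qed (use \<open>f u \<noteq> 0\<close> in simp)
qed

text \<open>
  The projector depends only continuously on \<open>h\<close>, so the inverse function theorem is not available;
  Brouwer's theorem still gives existence, and uniqueness of \<open>h\<close> is never needed.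
\<close>

lemma continuous_projection_along_surface:
  fixes S :: "'a::euclidean_space \<Rightarrow> 'b::real_normed_vector"
    and S' :: "'a \<Rightarrow> 'a \<Rightarrow>\<^sub>L 'b" and p :: "'a \<Rightarrow> 'b \<Rightarrow>\<^sub>L 'b"
  assumes r: "r > 0"
    and der: "(S has_derivative S' h0) (at h0)"
    and cont: "continuous_on (ball h0 r) S" "continuous_on (ball h0 r) S'" "continuous_on (ball h0 r) p"
    and inj: "inj (blinfun_apply (S' h0))"
    and p_range: "\<And>h x. h \<in> ball h0 r \<Longrightarrow> p h x \<in> range (S' h)"
    and p_fix: "\<And>v. p h0 (S' h0 v) = S' h0 v"
  obtains C s where "C > 0" "s > 0"
    "\<And>\<xi>. norm (\<xi> - S h0) < s \<Longrightarrow>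
      \<exists>h\<in>ball h0 r. norm (h - h0) \<le> C * norm (\<xi> - S h0) \<and> p h (\<xi> - S h) = 0"
proof -
  obtain c where c: "c > 0" "\<And>v. c * norm v \<le> norm (S' h0 v)"
    using inj_blinfun_bounded_below[OF inj] by blast
  have h0: "h0 \<in> ball h0 r" using r by simp
  \<comment> \<open>The coordinates of \<open>p h0 x\<close> with respect to \<open>S' h0\<close>.
    This extends the inverse of \<open>S' h0\<close> from its range to a bounded left inverse on the
    whole space.\<close>
  define l where "l x = inv (S' h0) (p h0 x)" for x
  have Sl: "S' h0 (l x) = p h0 x" for x
    unfolding l_def by (rule f_inv_into_f) (rule p_range[OF h0])
  have "bounded_linear l"
  proof (rule bounded_linear_intro[where K = "norm (p h0) / c"])
    show "l (x + y) = l x + l y" for x y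
      by (rule injD[OF inj]) (simp add: Sl blinfun.add_right)
    show "l (a *\<^sub>R x) = a *\<^sub>R l x" for a x
      by (rule injD[OF inj]) (simp add: Sl blinfun.scaleR_right)
    show "norm (l x) \<le> norm x * (norm (p h0) / c)" for x
      using c(2)[of "l x"] norm_blinfun[of "p h0" x] c(1) by (simp add: Sl field_simps)
  qed
  then obtain L where L: "blinfun_apply L = l"
    by (metis bounded_linear_Blinfun_apply)
  have LS: "L (S' h0 v) = v" for v
    unfolding L by (rule injD[OF inj]) (simp add: Sl p_fix)
  \<comment> \<open>Composing with \<open>L\<close> replaces \<open>p h x = 0\<close>, an equation
    in a subspace that moves with \<open>h\<close>, by one in the fixed Euclidean space, where
    Brouwer's theorem applies.\<close>
  define T where "T h = L o\<^sub>L p h" for h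
  have T0: "T h0 (S' h0 v) = v" for v by (simp add: T_def p_fix LS)
  define N where "N = norm L + norm (T h0) + 1"
  have N: "N > 0" "norm L \<le> N" "norm (T h0) < N" by (auto simp: N_def add_pos_nonneg intro: add_nonneg_pos)
  have contT: "continuous_on (ball h0 r) T"
    unfolding T_def by (intro continuous_intros cont)
  have cT: "(T \<longlongrightarrow> T h0) (nhds h0)" and cS': "(S' \<longlongrightarrow> S' h0) (nhds h0)"
    using contT cont(2) h0 by (auto simp: continuous_on_eq_continuous_at isCont_def tendsto_at_iff_tendsto_nhds)
  \<comment> \<open>The tolerances are such that the two errors in \<open>approx\<close> are at most
    a quarter of \<open>norm (h - h0)\<close> each, and that \<open>L\<close> composed with
    \<open>S' h\<close> stays within 1/2 of the identity.\<close>
  have "\<forall>\<^sub>F h in nhds h0. dist (T h) (T h0) < 1 / (4 * (norm (S' h0) + 1))"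
    by (rule tendstoD[OF cT]) (simp add: add_nonneg_pos)
  moreover have "\<forall>\<^sub>F h in nhds h0. norm (T h) < N"
    using tendsto_norm[OF cT] N(3) by (rule order_tendstoD)
  moreover have "\<forall>\<^sub>F h in nhds h0. dist (S' h) (S' h0) < 1 / (2 * N)"
    by (rule tendstoD[OF cS']) (use N in simp)
  moreover have "\<forall>\<^sub>F h in nhds h0. h \<in> ball h0 r"
    using h0 by (intro eventually_nhds_in_open) auto
  moreover have "\<forall>\<^sub>F h in nhds h0. norm (S h - S h0 - S' h0 (h - h0)) \<le> 1 / (4 * N) * norm (h - h0)"
  proof -
    have "1 / (4 * N) > 0" using N by simp
    then show ?thesis using der unfolding has_derivative_at_alt eventually_nhds_metric dist_norm by blast
  qed
  ultimately have "\<forall>\<^sub>F h in nhds h0. dist (T h) (T h0) < 1 / (4 * (norm (S' h0) + 1)) \<and>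
      norm (T h) < N \<and> dist (S' h) (S' h0) < 1 / (2 * N) \<and> h \<in> ball h0 r \<and>
      norm (S h - S h0 - S' h0 (h - h0)) \<le> 1 / (4 * N) * norm (h - h0)"
    by eventually_elim simp
  then obtain d where d: "d > 0" and near: "\<And>h. dist h h0 < d \<Longrightarrow>
      dist (T h) (T h0) < 1 / (4 * (norm (S' h0) + 1)) \<and>
      norm (T h) < N \<and> dist (S' h) (S' h0) < 1 / (2 * N) \<and> h \<in> ball h0 r \<and>
      norm (S h - S h0 - S' h0 (h - h0)) \<le> 1 / (4 * N) * norm (h - h0)"
    unfolding eventually_nhds_metric by blast
  have approx: "norm (T h (S h0 - S h) + (h - h0)) \<le> norm (h - h0) / 2" if h: "dist h h0 < d" for h
  proof -
    have "T h (S h0 - S h) + T h0 w = - (T h (S h - S h0 - w) + (T h - T h0) w)" for w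
      by (simp add: blinfun.diff_right blinfun.diff_left)
    from this[of "S' h0 (h - h0)"] have "T h (S h0 - S h) + (h - h0) =
        - (T h (S h - S h0 - S' h0 (h - h0)) + (T h - T h0) (S' h0 (h - h0)))"
      by (simp only: T0)
    then have "norm (T h (S h0 - S h) + (h - h0)) \<le>
        norm (T h (S h - S h0 - S' h0 (h - h0))) + norm ((T h - T h0) (S' h0 (h - h0)))"
      by (metis norm_minus_cancel norm_triangle_ineq)
    also have "norm (T h (S h - S h0 - S' h0 (h - h0))) \<le> N * (1 / (4 * N) * norm (h - h0))"
      using near[OF h] N(1) by (intro order_trans[OF norm_blinfun] mult_mono) auto
    also have "norm ((T h - T h0) (S' h0 (h - h0))) \<le>
        1 / (4 * (norm (S' h0) + 1)) * ((norm (S' h0) + 1) * norm (h - h0))"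
      using near[OF h] norm_blinfun[of "S' h0" "h - h0"]
      by (intro order_trans[OF norm_blinfun] mult_mono) (auto simp: dist_norm distrib_right add_nonneg_nonneg intro: order_trans)
    also have "\<dots> = norm (h - h0) / 4"
      using norm_ge_zero[of "S' h0"] by (simp add: field_simps add_nonneg_eq_0_iff)
    finally show ?thesis using N by simp
  qed
  \<comment> \<open>Nothing is lost by applying \<open>L\<close>: near \<open>h0\<close> it is
    injective on the range of \<open>S' h\<close>, where \<open>p h x\<close> lies.\<close>
  have T_zero: "p h x = 0" if h: "dist h h0 < d" and z: "T h x = 0" for h x
  proof -
    obtain v where v: "p h x = S' h v" using p_range near[OF h] by blast
    have "L (S' h v) = 0" using z v by (simp add: T_def)
    then have "v = L ((S' h0 - S' h) v)" by (simp add: blinfun.diff_left blinfun.diff_right LS)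
    then have "norm v \<le> norm L * norm ((S' h0 - S' h) v)" by (metis norm_blinfun)
    also have "\<dots> \<le> N * (1 / (2 * N) * norm v)"
      using near[OF h] N
      by (intro mult_mono order_trans[OF norm_blinfun]) (auto simp: dist_norm norm_minus_commute)
    finally show ?thesis using N v by (simp add: blinfun.zero_right)
  qed
  have "\<exists>h\<in>ball h0 r. norm (h - h0) \<le> (2 * N) * norm (\<xi> - S h0) \<and> p h (\<xi> - S h) = 0"
    if \<xi>: "norm (\<xi> - S h0) < d / (2 * N)" for \<xi>
  proof -
    \<comment> \<open>The map \<open>h + T h (\<xi> - S h)\<close> sends \<open>h\<close> to within
      \<open>N * norm (\<xi> - S h0)\<close>, which is \<open>\<rho> / 2\<close>, plus the
      linearisation error, again at most \<open>\<rho> / 2\<close>, of \<open>h0\<close>. Hence it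
      preserves this ball.\<close>
    define \<rho> where "\<rho> = 2 * N * norm (\<xi> - S h0)"
    have \<rho>: "\<rho> \<ge> 0" "\<rho> < d" using \<xi> N by (auto simp: \<rho>_def field_simps)
    have cd: "dist h h0 < d" if "h \<in> cball h0 \<rho>" for h using that \<rho> by (simp add: dist_commute)
    have sub: "cball h0 \<rho> \<subseteq> ball h0 r" using near[OF cd] by blast
    obtain h where h: "h \<in> cball h0 \<rho>" "h + T h (\<xi> - S h) = h"
    proof (rule brouwer[of "cball h0 \<rho>" "\<lambda>h. h + T h (\<xi> - S h)"])
      show "continuous_on (cball h0 \<rho>) (\<lambda>h. h + T h (\<xi> - S h))"
        by (intro continuous_intros continuous_on_subset[OF contT sub] continuous_on_subset[OF cont(1) sub])
      show "(\<lambda>h. h + T h (\<xi> - S h)) \<in> cball h0 \<rho> \<rightarrow> cball h0 \<rho>"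
      proof
        fix h assume h: "h \<in> cball h0 \<rho>"
        have "h + T h (\<xi> - S h) - h0 = T h (\<xi> - S h0) + (T h (S h0 - S h) + (h - h0))"
          by (simp add: blinfun.diff_right)
        also have "norm \<dots> \<le> N * norm (\<xi> - S h0) + \<rho> / 2"
        proof (rule norm_triangle_mono)
          show "norm (T h (\<xi> - S h0)) \<le> N * norm (\<xi> - S h0)"
            using near[OF cd[OF h]] by (intro order_trans[OF norm_blinfun] mult_right_mono) auto
          show "norm (T h (S h0 - S h) + (h - h0)) \<le> \<rho> / 2"
            using approx[OF cd[OF h]] h by (auto simp: dist_norm norm_minus_commute)
        qed
        also have "\<dots> = \<rho>" by (simp add: \<rho>_def)
        finally show "h + T h (\<xi> - S h) \<in> cball h0 \<rho>" by (simp add: dist_norm norm_minus_commute)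
      qed
    qed (use \<rho> in auto)
    have "p h (\<xi> - S h) = 0" by (rule T_zero[OF cd[OF h(1)]]) (use h(2) in simp)
    moreover have "norm (h - h0) \<le> \<rho>" using h(1) by (simp add: dist_norm norm_minus_commute)
    ultimately show ?thesis using sub h(1) unfolding \<rho>_def by blast
  qed
  then show thesis by (intro that[of "2 * N" "d / (2 * N)"]) (use N d in auto)
qed

section \<open>The reduction near a manifold of fixed points\<close>

locale fixed_point_manifold =
  fixes P :: "'e::banach \<Rightarrow> 'e"
    and P' :: "'e \<Rightarrow> 'e \<Rightarrow>\<^sub>L 'e"
    and Q :: "'e \<times> real \<Rightarrow> 'e"
    and h0 :: "'h::euclidean_space"
    and r0 :: real
    and S :: "'h \<Rightarrow> 'e"
    and S' :: "'h \<Rightarrow> 'h \<Rightarrow>\<^sub>L 'e"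
    and E1 E2 :: "'h \<Rightarrow> 'e set"
    and \<pi>1 \<pi>2 :: "'h \<Rightarrow> 'e \<Rightarrow>\<^sub>L 'e"
  assumes P_deriv: "\<And>x. (P has_derivative blinfun_apply (P' x)) (at x)"
    and P'_cont: "continuous_on UNIV P'"
    and Q_cont: "continuous_on (UNIV \<times> {0..1}) Q"
    and Q_lipschitz: "\<And>R. R > 0 \<Longrightarrow> \<exists>L>0. \<forall>\<xi>1\<in>ball 0 R. \<forall>\<xi>2\<in>ball 0 R. \<forall>\<epsilon>\<in>{0..1}.
        norm (Q (\<xi>1, \<epsilon>) - Q (\<xi>2, \<epsilon>)) \<le> L * norm (\<xi>1 - \<xi>2)"
    and r0_pos: "r0 > 0"
    and S_deriv: "\<And>h. h \<in> ball h0 r0 \<Longrightarrow> (S has_derivative blinfun_apply (S' h)) (at h)"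
    and S'_cont: "continuous_on (ball h0 r0) S'"
    and fixed_points: "\<And>h. h \<in> ball h0 r0 \<Longrightarrow> P (S h) = S h"
    and S'_inj: "inj (blinfun_apply (S' h0))"
    and E1_eq: "\<And>h. h \<in> ball h0 r0 \<Longrightarrow> E1 h = range (blinfun_apply (S' h))"
    and E2_compl: "\<And>h. h \<in> ball h0 r0 \<Longrightarrow> direct_sum_decomp (E1 h) (E2 h)"
    and \<pi>1_proj: "\<And>h. h \<in> ball h0 r0 \<Longrightarrow> projector_onto_along (\<pi>1 h) (E1 h) (E2 h)"
    and \<pi>2_proj: "\<And>h. h \<in> ball h0 r0 \<Longrightarrow> projector_onto_along (\<pi>2 h) (E2 h) (E1 h)"
    and \<pi>1_cont: "continuous_on (ball h0 r0) \<pi>1"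
    and \<pi>2_cont: "continuous_on (ball h0 r0) \<pi>2"
    and invertible: "invertible_on (\<pi>2 h0 o\<^sub>L (P' (S h0) - id_blinfun) o\<^sub>L \<pi>2 h0) (E2 h0)"
begin

text \<open>The operator whose inverse on \<open>E2 h\<close> gives the leading coefficient of
  \<open>\<beta>\<close> in \<open>\<epsilon>\<close>.\<close>

definition T :: "'h \<Rightarrow> 'e \<Rightarrow>\<^sub>L 'e" where
  "T h = \<pi>2 h o\<^sub>L (P' (S h) - id_blinfun) o\<^sub>L \<pi>2 h"

text \<open>
  Adding \<open>\<pi>1 h x\<close> turns the problem on the moving subspace \<open>E2 h\<close> into one on all of \<open>E\<close>.
\<close>

definition F :: "'h \<Rightarrow> real \<Rightarrow> 'e \<Rightarrow> 'e" where
  "F h \<epsilon> x = \<pi>1 h x + \<pi>2 h (P (x + S h) - (x + S h) + \<epsilon> *\<^sub>R Q (x + S h, \<epsilon>))"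

text \<open>The derivative in \<open>x\<close> of \<open>F h \<epsilon>\<close> without its
  \<open>Q\<close> term, which is only Lipschitz and is treated as a perturbation.\<close>

definition F' :: "'h \<Rightarrow> 'e \<Rightarrow> 'e \<Rightarrow>\<^sub>L 'e" where
  "F' h x = \<pi>1 h + (\<pi>2 h o\<^sub>L (P' (x + S h) - id_blinfun))"

lemma h0_in: "h0 \<in> ball h0 r0"
  using r0_pos by simp

section \<open>The splitting of the space at a fixed parameter\<close>

context
  fixes h
  assumes h: "h \<in> ball h0 r0"
begin

lemma subspaces: "subspace (E1 h)" "subspace (E2 h)"
  using E2_compl[OF h] by (auto simp: direct_sum_decomp_def)

lemma split_decomp:
  obtains v w where "v \<in> E1 h" "w \<in> E2 h" "x = v + w"
  using E2_compl[OF h] unfolding direct_sum_decomp_def by blast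

lemma proj_add:
  assumes "v \<in> E1 h" "w \<in> E2 h"
  shows "\<pi>1 h (v + w) = v" "\<pi>2 h (v + w) = w"
  using \<pi>1_proj[OF h] \<pi>2_proj[OF h] assms
  by (auto simp: projector_onto_along_def) (metis add.commute)

lemma proj_sum: "\<pi>1 h x + \<pi>2 h x = x"
  by (metis proj_add split_decomp)

lemma proj_in: "\<pi>1 h x \<in> E1 h" "\<pi>2 h x \<in> E2 h"
  by (metis proj_add split_decomp)+

lemma proj_E1:
  assumes "x \<in> E1 h"
  shows "\<pi>1 h x = x" "\<pi>2 h x = 0"
  using proj_add[OF assms subspace_0[OF subspaces(2)]] by simp_all

lemma proj_E2:
  assumes "x \<in> E2 h"
  shows "\<pi>1 h x = 0" "\<pi>2 h x = x"
  using proj_add[OF subspace_0[OF subspaces(1)] assms] by simp_all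

text \<open>On the ball \<open>P\<close> composed with \<open>S\<close> coincides with
  \<open>S\<close>, so the chain rule gives another expression for the derivative of
  \<open>S\<close> at \<open>h\<close>, and derivatives are unique.\<close>

lemma P'_E1:
  assumes "x \<in> E1 h"
  shows "P' (S h) x = x"
proof -
  obtain v where v: "x = S' h v" using assms E1_eq[OF h] by auto
  have "((\<lambda>k. P (S k)) has_derivative (\<lambda>k. P' (S h) (S' h k))) (at h)"
    using has_derivative_compose[OF S_deriv[OF h] P_deriv] by simp
  then have "(S has_derivative (\<lambda>k. P' (S h) (S' h k))) (at h)"
    by (rule has_derivative_transform_within_open[OF _ open_ball h]) (simp add: fixed_points)
  then have "(\<lambda>k. P' (S h) (S' h k)) = S' h"
    using S_deriv[OF h] by (rule has_derivative_unique)
  then show ?thesis using v by metis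
qed

text \<open>\<open>P' (S h) - I\<close> kills the \<open>E1 h\<close> component of \<open>x\<close>,
  so the right factor \<open>\<pi>2 h\<close> of \<open>T h\<close> can be inserted freely.\<close>

lemma F'_0: "F' h 0 x = \<pi>1 h x + T h x"
proof -
  have "P' (S h) (\<pi>1 h x) = \<pi>1 h x" by (rule P'_E1[OF proj_in(1)])
  moreover have "P' (S h) x - x = (P' (S h) (\<pi>1 h x) - \<pi>1 h x) + (P' (S h) (\<pi>2 h x) - \<pi>2 h x)"
    by (metis (no_types, lifting) add_diff_add blinfun.add_right proj_sum)
  ultimately show ?thesis
    by (simp add: F'_def T_def blinfun.add_left blinfun.diff_left)
qed

lemma T_in: "T h x \<in> E2 h"
  by (simp add: T_def proj_in)

lemma E1_E2_sum_eq:
  assumes "v \<in> E1 h" "v' \<in> E1 h" "w \<in> E2 h" "w' \<in> E2 h" "v + w = v' + w'"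
  shows "v = v'" "w = w'"
  using proj_add[OF assms(1,3)] proj_add[OF assms(2,4)] assms(5) by simp_all

text \<open>In the splitting, \<open>F' h 0\<close> is block diagonal: the identity on
  \<open>E1 h\<close> and \<open>T h\<close> on \<open>E2 h\<close>. One direction carries the
  hypothesis at \<open>h0\<close> to the whole space; the other brings invertibility at nearby
  \<open>h\<close> back to \<open>E2 h\<close>.\<close>

lemma bij_F'_iff: "bij (F' h 0) \<longleftrightarrow> invertible_on (T h) (E2 h)"
proof
  assume bij: "bij (F' h 0)"
  have T_E2: "T h x = F' h 0 x" if "x \<in> E2 h" for x
    using that by (simp add: F'_0 proj_E2)
  show "invertible_on (T h) (E2 h)"
    unfolding invertible_on_def
  proof (rule bij_betw_imageI)
    show "inj_on (T h) (E2 h)"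
      using bij by (metis T_E2 bij_is_inj injD inj_onI)
    show "T h ` E2 h = E2 h"
    proof
      show "T h ` E2 h \<subseteq> E2 h" using T_in by auto
      show "E2 h \<subseteq> T h ` E2 h"
      proof
        fix y assume y: "y \<in> E2 h"
        obtain x where x: "y = F' h 0 x" using bij by (metis bij_is_surj surjD)
        then have "\<pi>1 h x + T h x = 0 + y" by (simp add: F'_0)
        then have "\<pi>1 h x = 0"
          by (intro E1_E2_sum_eq(1)[OF proj_in(1) subspace_0[OF subspaces(1)] T_in y])
        then have "x \<in> E2 h" using proj_sum[of x] proj_in(2)[of x] by simp
        then show "y \<in> T h ` E2 h" using x T_E2 by (metis image_eqI)
      qed
    qed
  qed
next
  assume "invertible_on (T h) (E2 h)"
  then have inj: "inj_on (T h) (E2 h)" and im: "T h ` E2 h = E2 h"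
    by (auto simp: invertible_on_def bij_betw_def)
  have Tp: "T h x = T h (\<pi>2 h x)" for x
    by (simp add: T_def proj_E2(2)[OF proj_in(2)])
  show "bij (F' h 0)"
  proof (rule bijI)
    show "inj (F' h 0)"
    proof (rule injI)
      fix x y assume "F' h 0 x = F' h 0 y"
      then have "\<pi>1 h x + T h x = \<pi>1 h y + T h y" by (simp add: F'_0)
      note eq = E1_E2_sum_eq[OF proj_in(1) proj_in(1) T_in T_in this]
      then have "\<pi>2 h x = \<pi>2 h y"
        using inj proj_in(2) Tp by (metis inj_onD)
      with eq(1) show "x = y" by (metis proj_sum)
    qed
    show "surj (F' h 0)"
      unfolding surj_def
    proof
      show "\<exists>x. y = F' h 0 x" for y
      proof -
        obtain w where w: "w \<in> E2 h" "T h w = \<pi>2 h y" using im proj_in(2) by (metis imageE)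
        have "\<pi>1 h (\<pi>1 h y + w) = \<pi>1 h y" "\<pi>2 h (\<pi>1 h y + w) = w"
          by (rule proj_add[OF proj_in(1) w(1)])+
        then have "F' h 0 (\<pi>1 h y + w) = y" using w(2) Tp[of "\<pi>1 h y + w"] proj_sum by (simp add: F'_0)
        then show ?thesis by metis
      qed
    qed
  qed
qed

text \<open>On \<open>E2 h\<close> the operators \<open>T h\<close> and \<open>F' h 0\<close> agree.
  This identifies the solution of the linearised equation with the expression in the
  theorem.\<close>

lemma inverse_on_T:
  assumes inv: "invertible_on (T h) (E2 h)" and y: "y \<in> E2 h"
  shows "F' h 0 (inverse_on (T h) (E2 h) y) = y"
proof -
  have im: "T h ` E2 h = E2 h" using inv by (auto simp: invertible_on_def bij_betw_def)
  have "inverse_on (T h) (E2 h) y \<in> E2 h" "T h (inverse_on (T h) (E2 h) y) = y"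
    unfolding inverse_on_def using y im by (metis inv_into_into, metis f_inv_into_f)
  then show ?thesis by (simp add: F'_0 proj_E2)
qed

text \<open>The two summands of \<open>F\<close> lie in complementary subspaces, so one equation
  encodes both the constraint and the projected equation.\<close>

lemma F_zero_iff:
  "F h \<epsilon> x = 0 \<longleftrightarrow> x \<in> E2 h \<and> \<pi>2 h (P (x + S h) - (x + S h) + \<epsilon> *\<^sub>R Q (x + S h, \<epsilon>)) = 0"
proof
  assume "F h \<epsilon> x = 0"
  then have "\<pi>1 h x + \<pi>2 h (P (x + S h) - (x + S h) + \<epsilon> *\<^sub>R Q (x + S h, \<epsilon>)) = 0 + 0"
    by (simp add: F_def)
  note eq = E1_E2_sum_eq[OF proj_in(1) subspace_0[OF subspaces(1)] proj_in(2) subspace_0[OF subspaces(2)] this]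
  then have "x \<in> E2 h" using proj_sum[of x] proj_in(2)[of x] by simp
  with eq(2) show "x \<in> E2 h \<and> \<pi>2 h (P (x + S h) - (x + S h) + \<epsilon> *\<^sub>R Q (x + S h, \<epsilon>)) = 0" by simp
qed (simp add: F_def proj_E2)

lemma F_0: "F h \<epsilon> 0 = \<epsilon> *\<^sub>R \<pi>2 h (Q (S h, \<epsilon>))"
  by (simp add: F_def fixed_points[OF h] blinfun.zero_right blinfun.scaleR_right)

end

section \<open>Continuity near the base point\<close>

lemma S_cont: "continuous_on (ball h0 r0) S"
  by (rule has_derivative_continuous_on[OF has_derivative_at_withinI[OF S_deriv]])

text \<open>Joint continuity at \<open>(h0, 0)\<close> in the operator norm. Taking
  \<open>\<rho>\<close> strictly below \<open>r0\<close> puts a closed, hence compact, ball of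
  parameters inside the domain.\<close>

lemma F'_near:
  assumes "e > 0"
  obtains \<rho> where "0 < \<rho>" "\<rho> < r0"
    "\<And>h x. h \<in> cball h0 \<rho> \<Longrightarrow> x \<in> cball 0 \<rho> \<Longrightarrow> norm (F' h x - F' h0 0) \<le> e"
proof -
  have isC: "isCont f h0" if "continuous_on (ball h0 r0) f" for f :: "'h \<Rightarrow> 'z::topological_space"
    using that h0_in by (simp add: continuous_on_eq_continuous_at)
  have cf: "isCont (\<lambda>z::'h \<times> 'e. f (fst z)) (h0, 0)" if "continuous_on (ball h0 r0) f" for f :: "'h \<Rightarrow> 'z::topological_space"
    by (rule isCont_o2[where g = f and f = fst]) (use isC[OF that] in \<open>auto intro: continuous_intros\<close>)
  have cP: "isCont (\<lambda>z. P' (snd z + S (fst z))) (h0, 0)"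
    by (rule isCont_o2[where g = P'])
      (use P'_cont in \<open>auto simp: continuous_on_eq_continuous_at intro!: continuous_intros cf S_cont\<close>)
  have "isCont (\<lambda>z. F' (fst z) (snd z)) (h0, 0)"
    unfolding F'_def
    by (intro continuous_add bounded_bilinear.continuous[OF bounded_bilinear_blinfun_compose]
        continuous_diff continuous_const cP cf \<pi>1_cont \<pi>2_cont)
  then obtain d where d: "d > 0"
    "\<And>z. dist z (h0, 0) < d \<Longrightarrow> dist (F' (fst z) (snd z)) (F' h0 0) < e"
    using assms unfolding continuous_at_eps_delta by fastforce
  define \<rho> where "\<rho> = min (d / 3) (r0 / 2)"
  show thesis
  proof (rule that[of \<rho>])
    fix h x assume "h \<in> cball h0 \<rho>" "x \<in> cball (0::'e) \<rho>"
    then have "dist (h, x) (h0, 0) < d"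
      using norm_Pair_le[of "h - h0" x] d(1) by (auto simp: dist_norm norm_minus_commute \<rho>_def)
    from d(2)[OF this] show "norm (F' h x - F' h0 0) \<le> e" by (simp add: dist_norm)
  qed (use d(1) r0_pos in \<open>auto simp: \<rho>_def\<close>)
qed

lemma F_deriv: "((\<lambda>x. \<pi>1 h x + \<pi>2 h (P (x + S h) - (x + S h))) has_derivative F' h x) (at x)"
proof -
  have P: "((\<lambda>x. P (x + S h)) has_derivative P' (x + S h)) (at x)"
    by (rule has_derivative_compose[of "\<lambda>x. x + S h" "\<lambda>x. x" x UNIV P, OF _ P_deriv])
      (auto intro!: derivative_eq_intros)
  have "((\<lambda>x. \<pi>1 h x + \<pi>2 h (P (x + S h) - (x + S h))) has_derivative
      (\<lambda>v. \<pi>1 h v + \<pi>2 h (P' (x + S h) v - (v + 0)))) (at x)"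
    by (intro has_derivative_add has_derivative_diff P has_derivative_const has_derivative_ident
        bounded_linear.has_derivative[OF blinfun.bounded_linear_right]
        blinfun.bounded_linear_right[THEN bounded_linear_imp_has_derivative])
  moreover have "(\<lambda>v. \<pi>1 h v + \<pi>2 h (P' (x + S h) v - (v + 0))) = F' h x"
    by (simp add: fun_eq_iff F'_def blinfun.add_left blinfun.diff_left)
  ultimately show ?thesis by simp
qed

text \<open>A perturbation of norm below the lower bound \<open>c\<close> of \<open>S' h0\<close>
  cannot cancel it on a nonzero vector.\<close>

lemma S'_inj_near:
  obtains q where "0 < q" "q \<le> r0" "\<And>h. h \<in> ball h0 q \<Longrightarrow> inj (S' h)"
proof -
  obtain c where c: "c > 0" "\<And>v. c * norm v \<le> norm (S' h0 v)"
    using inj_blinfun_bounded_below[OF S'_inj] by blast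
  have "isCont S' h0"
    using S'_cont h0_in by (simp add: continuous_on_eq_continuous_at)
  then obtain q where q: "q > 0" "\<And>h. dist h h0 < q \<Longrightarrow> dist (S' h) (S' h0) < c"
    using c(1) unfolding continuous_at_eps_delta by blast
  show thesis
  proof (rule that[of "min q r0"])
    fix h assume "h \<in> ball h0 (min q r0)"
    then have close: "norm (S' h - S' h0) < c" using q(2)[of h] by (simp add: dist_commute flip: dist_norm)
    show "inj (S' h)"
    proof (rule injI, rule ccontr)
      fix u v assume eq: "S' h u = S' h v" and "u \<noteq> v"
      have "S' h0 (u - v) = - ((S' h - S' h0) (u - v))"
        using eq by (simp add: blinfun.diff_left blinfun.diff_right)
      then have "c * norm (u - v) \<le> norm (S' h - S' h0) * norm (u - v)"
        by (metis c(2) norm_blinfun norm_minus_cancel order_trans)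
      then show False using close \<open>u \<noteq> v\<close> by simp
    qed
  qed (use q r0_pos in auto)
qed

section \<open>The branch of small zeros\<close>

text \<open>The inverse at \<open>h0\<close> drives the iteration for all nearby \<open>h\<close>
  and small \<open>\<epsilon>\<close>, so all constants are uniform. The bound \<open>q\<close> lets
  the caller shrink the ball; \<open>y\<close> is any solution of the linearised equation, which
  keeps inverses on subspaces out of the estimates.\<close>

lemma small_zero_branch:
  assumes "0 < q"
  obtains r M \<rho> \<beta> where
    "0 < r" "r < r0" "r \<le> 1" "r \<le> q" "0 < M" "0 < \<rho>"
    "\<And>h. h \<in> ball h0 r \<Longrightarrow> bij (F' h 0)"
    "\<And>\<epsilon>. \<epsilon> \<in> {0..r} \<Longrightarrow> continuous_on (ball h0 r) (\<lambda>h. \<beta> h \<epsilon>)"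
    "\<And>h \<epsilon>. h \<in> ball h0 r \<Longrightarrow> \<epsilon> \<in> {0..r} \<Longrightarrow> norm (\<beta> h \<epsilon>) \<le> M * \<epsilon>"
    "\<And>h \<epsilon>. h \<in> ball h0 r \<Longrightarrow> \<epsilon> \<in> {0..r} \<Longrightarrow> F h \<epsilon> (\<beta> h \<epsilon>) = 0"
    "\<And>h \<epsilon> x. h \<in> ball h0 r \<Longrightarrow> \<epsilon> \<in> {0..r} \<Longrightarrow> norm x \<le> \<rho> \<Longrightarrow> F h \<epsilon> x = 0 \<Longrightarrow> \<beta> h \<epsilon> = x"
    "\<And>y. (\<And>h. h \<in> ball h0 r \<Longrightarrow> F' h 0 (y h) = \<pi>2 h (Q (S h, 0))) \<Longrightarrow>
      uniform_limit (ball h0 r) (\<lambda>\<epsilon> h. \<beta> h \<epsilon> /\<^sub>R \<epsilon>) (\<lambda>h. - y h) (at_right 0)"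
proof -
  define A where "A = F' h0 0"
  have "bij A"
    unfolding A_def using bij_F'_iff[OF h0_in] invertible by (simp add: T_def)
  then obtain B where BA: "\<And>x. blinfun_apply B (A x) = x" and AB: "\<And>y. A (blinfun_apply B y) = y"
    using bij_blinfun_inverse by blast
  define b where "b = norm B + 1"
  have b: "b > 0" "norm B \<le> b" by (auto simp: b_def add_nonneg_pos)
  \<comment> \<open>\<open>1 / (4 * b)\<close> is half of the allowed perturbation
    \<open>1 / (2 * b)\<close>; the other half is left for the \<open>Q\<close> term.\<close>
  obtain \<rho> where \<rho>: "0 < \<rho>" "\<rho> < r0"
    and near: "\<And>h x. h \<in> cball h0 \<rho> \<Longrightarrow> x \<in> cball 0 \<rho> \<Longrightarrow> norm (F' h x - A) \<le> 1 / (4 * b)"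
    using F'_near[of "1 / (4 * b)"] b unfolding A_def by auto
  define K where "K = cball h0 \<rho>"
  have K: "compact K" "K \<subseteq> ball h0 r0" using \<rho> by (auto simp: K_def)
  have cS: "continuous_on K S" by (rule continuous_on_subset[OF S_cont K(2)])
  have c\<pi>: "continuous_on K \<pi>2" by (rule continuous_on_subset[OF \<pi>2_cont K(2)])
  have cQ: "continuous_on (K \<times> {0..1}) (\<lambda>z. Q (S (fst z), snd z))"
    by (rule continuous_on_compose2[OF Q_cont])
      (auto intro!: continuous_intros continuous_on_compose2[OF cS])
  have KQ: "compact (K \<times> {0..1::real})" using K by (intro compact_Times) auto
  obtain RS where RS: "RS > 0" "\<And>h. h \<in> K \<Longrightarrow> norm (S h) \<le> RS"
    using compact_imp_bounded[OF compact_continuous_image[OF cS K(1)]] by (auto simp: bounded_pos)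
  obtain N where N: "N > 0" "\<And>h. h \<in> K \<Longrightarrow> norm (\<pi>2 h) \<le> N"
    using compact_imp_bounded[OF compact_continuous_image[OF c\<pi> K(1)]] by (auto simp: bounded_pos)
  obtain C where C: "C > 0" "\<And>h \<epsilon>. h \<in> K \<Longrightarrow> \<epsilon> \<in> {0..1} \<Longrightarrow> norm (Q (S h, \<epsilon>)) \<le> C"
    using compact_imp_bounded[OF compact_continuous_image[OF cQ KQ]] by (auto simp: bounded_pos)
  have N_app: "norm (\<pi>2 h v) \<le> N * norm v" if "h \<in> K" for h v
    by (meson N(2)[OF that] mult_right_mono norm_blinfun norm_ge_zero order_trans)
  \<comment> \<open>The radius covers all \<open>x + S h\<close> in question; the extra 1 is there
    because the Lipschitz condition is on open balls.\<close>
  obtain L where L: "L > 0" "\<And>x y \<epsilon>. x \<in> ball 0 (RS + \<rho> + 1) \<Longrightarrow> y \<in> ball 0 (RS + \<rho> + 1) \<Longrightarrow> \<epsilon> \<in> {0..1} \<Longrightarrow>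
      norm (Q (x, \<epsilon>) - Q (y, \<epsilon>)) \<le> L * norm (x - y)"
    using Q_lipschitz[of "RS + \<rho> + 1"] RS \<rho> by auto
  have LS: "norm (Q (x + S h, \<epsilon>) - Q (y + S h, \<epsilon>)) \<le> L * norm (x - y)"
    if "h \<in> K" "x \<in> cball 0 \<rho>" "y \<in> cball 0 \<rho>" "\<epsilon> \<in> {0..1}" for h x y \<epsilon>
  proof -
    have "z + S h \<in> ball 0 (RS + \<rho> + 1)" if "z \<in> cball 0 \<rho>" for z
      using that RS(2)[OF \<open>h \<in> K\<close>] norm_triangle_ineq[of z "S h"] by simp
    from L(2)[OF this[OF that(2)] this[OF that(3)] that(4)] show ?thesis by simp
  qed
  \<comment> \<open>Here \<open>\<rho>\<close> keeps \<open>h\<close> in \<open>K\<close>, 1 keeps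
    \<open>\<epsilon>\<close> in the domain of \<open>Q\<close>, the fourth entry makes the
    \<open>Q\<close> term Lipschitz with constant \<open>1 / (4 * b)\<close>, and the last makes
    \<open>F h \<epsilon> 0\<close> small enough to start the iteration.\<close>
  define r where "r = Min {q, \<rho>, 1, 1 / (4 * b * N * L), \<rho> / (2 * b * N * C)}"
  have r: "r > 0" "r \<le> \<rho>" "r \<le> 1" "r \<le> q" and "r \<le> 1 / (4 * b * N * L)" "r \<le> \<rho> / (2 * b * N * C)"
    using assms \<rho> b N L C by (auto simp: r_def)
  then have rL: "r * (N * L) \<le> 1 / (4 * b)" and rC: "2 * b * (r * (N * C)) \<le> \<rho>"
    using b N L C by (auto simp: field_simps)
  have rK: "h \<in> K" if "h \<in> ball h0 r" for h using that r by (auto simp: K_def)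
  have K0: "h \<in> ball h0 r0" if "h \<in> K" for h using that K by auto

  have lip: "norm (F h \<epsilon> x - F h \<epsilon> y - A (x - y)) \<le> norm (x - y) / (2 * b)"
    if h: "h \<in> K" and \<epsilon>: "\<epsilon> \<in> {0..r}" and x: "x \<in> cball 0 \<rho>" and y: "y \<in> cball 0 \<rho>" for h \<epsilon> x y
  proof -
    define g where "g x = \<pi>1 h x + \<pi>2 h (P (x + S h) - (x + S h)) - A x" for x
    have g: "norm (g x - g y) \<le> 1 / (4 * b) * norm (x - y)"
    proof (rule differentiable_bound[OF convex_cball _ _ x y])
      show "(g has_derivative blinfun_apply (F' h z - A)) (at z within cball 0 \<rho>)" for z
      proof (rule has_derivative_at_withinI)
        have "(g has_derivative (\<lambda>v. F' h z v - A v)) (at z)"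
          unfolding g_def
          by (intro has_derivative_diff F_deriv bounded_linear_imp_has_derivative blinfun.bounded_linear_right)
        moreover have "(\<lambda>v. F' h z v - A v) = F' h z - A" by (simp add: fun_eq_iff blinfun.diff_left)
        ultimately show "(g has_derivative blinfun_apply (F' h z - A)) (at z)" by simp
      qed
      show "onorm (blinfun_apply (F' h z - A)) \<le> 1 / (4 * b)" if "z \<in> cball 0 \<rho>" for z
        using near[OF h[unfolded K_def] that] by (simp add: norm_blinfun.rep_eq)
    qed
    have "F h \<epsilon> x - F h \<epsilon> y - A (x - y) = (g x - g y) + \<epsilon> *\<^sub>R \<pi>2 h (Q (x + S h, \<epsilon>) - Q (y + S h, \<epsilon>))"
      by (simp add: F_def g_def blinfun.diff_right blinfun.add_right blinfun.scaleR_right algebra_simps)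
    also have "norm \<dots> \<le> 1 / (4 * b) * norm (x - y) + 1 / (4 * b) * norm (x - y)"
    proof (rule norm_triangle_mono[OF g])
      have "norm (\<pi>2 h (Q (x + S h, \<epsilon>) - Q (y + S h, \<epsilon>))) \<le> N * (L * norm (x - y))"
        using LS[OF h x y, of \<epsilon>] \<epsilon> r N by (intro order_trans[OF N_app[OF h]] mult_left_mono) auto
      then have "norm (\<epsilon> *\<^sub>R \<pi>2 h (Q (x + S h, \<epsilon>) - Q (y + S h, \<epsilon>))) \<le> r * (N * (L * norm (x - y)))"
        using \<epsilon> r unfolding norm_scaleR by (intro mult_mono) auto
      also have "\<dots> = r * (N * L) * norm (x - y)" by simp
      also have "\<dots> \<le> 1 / (4 * b) * norm (x - y)" by (rule mult_right_mono[OF rL norm_ge_zero])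
      finally show "norm (\<epsilon> *\<^sub>R \<pi>2 h (Q (x + S h, \<epsilon>) - Q (y + S h, \<epsilon>))) \<le> 1 / (4 * b) * norm (x - y)" .
    qed
    also have "\<dots> = norm (x - y) / (2 * b)" using b by (simp add: field_simps)
    finally show ?thesis .
  qed
  \<comment> \<open>This inequality yields the size of \<open>\<beta>\<close> (against 0), its
    continuity in \<open>h\<close> (against its value at another parameter) and its uniqueness
    (against another zero).\<close>
  have stab: "norm (x - y) \<le> 2 * b * norm (F h \<epsilon> x - F h \<epsilon> y)"
    if "h \<in> K" "\<epsilon> \<in> {0..r}" "x \<in> cball 0 \<rho>" "y \<in> cball 0 \<rho>" for h \<epsilon> x y
    by (rule perturbed_inverse_lower_bound[OF BA b lip[OF that]])
  have F0: "norm (F h \<epsilon> 0) \<le> \<epsilon> * (N * C)" if "h \<in> K" "\<epsilon> \<in> {0..r}" for h \<epsilon>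
  proof -
    have "norm (\<pi>2 h (Q (S h, \<epsilon>))) \<le> N * C"
      using C(2)[OF that(1), of \<epsilon>] that(2) r N by (intro order_trans[OF N_app[OF that(1)]] mult_left_mono) auto
    then show ?thesis using that(2) by (auto simp: F_0[OF K0[OF that(1)]] intro!: mult_left_mono)
  qed
  have "\<exists>x. x \<in> cball 0 \<rho> \<and> F h \<epsilon> x = 0" if h: "h \<in> K" and \<epsilon>: "\<epsilon> \<in> {0..r}" for h \<epsilon>
  proof -
    have "\<epsilon> * (N * C) \<le> r * (N * C)" using \<epsilon> N C by (intro mult_right_mono) auto
    then have "2 * b * norm (F h \<epsilon> 0) \<le> 2 * b * (r * (N * C))"
      using F0[OF that] b by (intro mult_left_mono) auto
    then have "2 * b * norm (F h \<epsilon> 0) \<le> \<rho>" using rC by linarith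
    from perturbed_inverse_zero[of B A b \<rho> "F h \<epsilon>", OF BA AB b lip[OF that] this] show ?thesis by blast
  qed
  then obtain \<beta> where \<beta>: "\<And>h \<epsilon>. h \<in> K \<Longrightarrow> \<epsilon> \<in> {0..r} \<Longrightarrow> \<beta> h \<epsilon> \<in> cball 0 \<rho>"
    "\<And>h \<epsilon>. h \<in> K \<Longrightarrow> \<epsilon> \<in> {0..r} \<Longrightarrow> F h \<epsilon> (\<beta> h \<epsilon>) = 0"
    by metis
  define M where "M = 2 * b * (N * C)"
  have M: "M > 0" using b N C by (simp add: M_def)
  have \<beta>_le: "norm (\<beta> h \<epsilon>) \<le> M * \<epsilon>" if "h \<in> K" "\<epsilon> \<in> {0..r}" for h \<epsilon>
  proof -
    have "norm (\<beta> h \<epsilon> - 0) \<le> 2 * b * norm (F h \<epsilon> (\<beta> h \<epsilon>) - F h \<epsilon> 0)"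
      by (rule stab[OF that \<beta>(1)[OF that]]) (use \<rho> in simp)
    also have "\<dots> \<le> 2 * b * (\<epsilon> * (N * C))"
      using F0[OF that] b by (intro mult_left_mono) (auto simp: \<beta>(2)[OF that])
    finally show ?thesis by (simp add: M_def mult_ac)
  qed
  \<comment> \<open>The linear map \<open>F' h 0\<close> is itself a perturbation of
    \<open>A\<close>, with an estimate valid on the whole space. So it is bijective for every
    \<open>h\<close> in \<open>K\<close>, with a lower bound independent of
    \<open>h\<close>.\<close>
  have F'_close: "norm (F' h 0 x - F' h 0 y - A (x - y)) \<le> norm (x - y) / (2 * b)" if "h \<in> K" for h x y
  proof -
    have "F' h 0 x - F' h 0 y - A (x - y) = (F' h 0 - A) (x - y)"
      by (simp add: blinfun.diff_left blinfun.diff_right)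
    also have "norm \<dots> \<le> 1 / (4 * b) * norm (x - y)"
      using near[OF that[unfolded K_def], of 0] \<rho>
      by (intro order_trans[OF norm_blinfun] mult_right_mono) auto
    also have "\<dots> \<le> norm (x - y) / (2 * b)" using b by (simp add: field_simps)
    finally show ?thesis .
  qed
  have F'_below: "norm (x - y) \<le> 2 * b * norm (F' h 0 x - F' h 0 y)" if "h \<in> K" for h x y
    by (rule perturbed_inverse_lower_bound[where G = "F' h 0", OF BA b F'_close[OF that]])
  have F'_bij: "bij (F' h 0)" if h: "h \<in> K" for h
  proof (rule bijI)
    show "inj (F' h 0)"
      using F'_below[OF h] by (intro injI) (metis diff_self mult_zero_right norm_le_zero_iff norm_zero right_minus_eq)
    show "surj (F' h 0)"
      unfolding surj_def
    proof
      fix y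
      \<comment> \<open>The perturbed map takes the value \<open>- y\<close> at 0, which dictates
        the radius \<open>2 * b * norm y\<close>.\<close>
      obtain x where "F' h 0 x - y = 0"
        by (rule perturbed_inverse_zero[of B A b "2 * b * norm y" "\<lambda>x. F' h 0 x - y", OF BA AB b])
          (use F'_close[OF h] in \<open>auto simp: blinfun.zero_right\<close>)
      then show "\<exists>x. y = F' h 0 x" by (intro exI[of _ x]) simp
    qed
  qed
  have \<beta>_cont: "continuous_on (ball h0 r) (\<lambda>h. \<beta> h \<epsilon>)" if \<epsilon>: "\<epsilon> \<in> {0..r}" for \<epsilon>
    unfolding continuous_on_def
  proof
    fix h1 assume h1: "h1 \<in> ball h0 r"
    \<comment> \<open>The vector is frozen at its value for \<open>h1\<close> and only
      \<open>h\<close> varies: the residual tends to 0, and \<open>stab\<close> converts it into a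
      distance.\<close>
    let ?x = "\<beta> h1 \<epsilon>"
    have "continuous_on (ball h0 r) (\<lambda>h. F h \<epsilon> ?x)"
    proof -
      have sub: "ball h0 r \<subseteq> ball h0 r0" using r \<rho> by auto
      have cS: "continuous_on (ball h0 r) S" by (rule continuous_on_subset[OF S_cont sub])
      have cP: "continuous_on UNIV P"
        by (rule has_derivative_continuous_on[OF has_derivative_at_withinI[OF P_deriv]])
      have cPS: "continuous_on (ball h0 r) (\<lambda>h. P (?x + S h))"
        by (rule continuous_on_compose2[OF cP]) (auto intro!: continuous_intros cS)
      have cQS: "continuous_on (ball h0 r) (\<lambda>h. Q (?x + S h, \<epsilon>))"
        by (rule continuous_on_compose2[OF Q_cont]) (use \<epsilon> r in \<open>auto intro!: continuous_intros cS\<close>)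
      show ?thesis unfolding F_def
        by (intro continuous_intros cS cPS cQS continuous_on_subset[OF \<pi>1_cont sub] continuous_on_subset[OF \<pi>2_cont sub])
    qed
    then have "((\<lambda>h. F h \<epsilon> ?x) \<longlongrightarrow> F h1 \<epsilon> ?x) (at h1 within ball h0 r)"
      using h1 by (auto simp: continuous_on_def)
    then have "((\<lambda>h. 2 * b * norm (F h \<epsilon> ?x)) \<longlongrightarrow> 2 * b * norm (F h1 \<epsilon> ?x)) (at h1 within ball h0 r)"
      by (intro tendsto_intros)
    then have lim: "((\<lambda>h. 2 * b * norm (F h \<epsilon> ?x)) \<longlongrightarrow> 0) (at h1 within ball h0 r)"
      using \<beta>(2)[OF rK[OF h1] \<epsilon>] by simp
    have "norm (\<beta> h \<epsilon> - ?x) \<le> 2 * b * norm (F h \<epsilon> ?x)" if "h \<in> ball h0 r" for h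
      using stab[OF rK[OF that] \<epsilon> \<beta>(1)[OF rK[OF that] \<epsilon>] \<beta>(1)[OF rK[OF h1] \<epsilon>]]
      by (simp add: \<beta>(2)[OF rK[OF that] \<epsilon>])
    then have "\<forall>\<^sub>F h in at h1 within ball h0 r. norm (\<beta> h \<epsilon> - ?x) \<le> 2 * b * norm (F h \<epsilon> ?x)"
      by (auto simp: eventually_at_filter)
    from Lim_null_comparison[OF this lim] show "((\<lambda>h. \<beta> h \<epsilon>) \<longlongrightarrow> ?x) (at h1 within ball h0 r)"
      using Lim_null by blast
  qed
  have limit: "uniform_limit (ball h0 r) (\<lambda>\<epsilon> h. \<beta> h \<epsilon> /\<^sub>R \<epsilon>) (\<lambda>h. - y h) (at_right 0)"
    if y: "\<And>h. h \<in> ball h0 r \<Longrightarrow> F' h 0 (y h) = \<pi>2 h (Q (S h, 0))" for y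
    unfolding uniform_limit_iff
  proof (intro allI impI)
    fix e :: real assume e: "e > 0"
    \<comment> \<open>\<open>D\<close> gathers the constants of the final estimate: \<open>M\<close>
      from the Taylor remainder of \<open>P\<close>, \<open>L * M\<close> from moving the first
      argument of \<open>Q\<close> by \<open>\<beta>\<close>, and 1 from moving its second
      argument.\<close>
    define D where "D = 2 * b * N * (M + L * M + 1)"
    have D: "D > 0" using b N M L by (simp add: D_def add_pos_pos)
    define e1 where "e1 = e / (2 * D)"
    have e1: "e1 > 0" using e D by (simp add: e1_def)
    obtain d1 where d1: "d1 > 0" "\<And>x v. x \<in> S ` K \<Longrightarrow> norm v < d1 \<Longrightarrow> norm (P (x + v) - P x - P' x v) \<le> e1 * norm v"
      using compact_uniformly_differentiable[OF P_deriv P'_cont compact_continuous_image[OF cS K(1)] e1] by blast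
    obtain d2 where d2: "d2 > 0" "\<And>z z'. z \<in> K \<times> {0..1} \<Longrightarrow> z' \<in> K \<times> {0..1} \<Longrightarrow> dist z' z < d2 \<Longrightarrow>
        dist (Q (S (fst z'), snd z')) (Q (S (fst z), snd z)) < e1"
      using compact_uniformly_continuous[OF cQ KQ] e1 unfolding uniformly_continuous_on_def by metis
    \<comment> \<open>\<open>d1 / M\<close> brings \<open>\<beta>\<close> within reach of the
      uniform linearisation of \<open>P\<close>, \<open>d2\<close> controls the change of
      \<open>Q\<close> in \<open>\<epsilon>\<close>, and \<open>e1\<close> bounds
      \<open>norm \<beta>\<close> by \<open>M * e1\<close>.\<close>
    define d where "d = Min {r, d1 / M, d2, e1}"
    have d: "d > 0" "d \<le> r" "d \<le> d1 / M" "d \<le> d2" "d \<le> e1" using r d1 d2 e1 M by (auto simp: d_def)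
    show "\<forall>\<^sub>F \<epsilon> in at_right 0. \<forall>h\<in>ball h0 r. dist (\<beta> h \<epsilon> /\<^sub>R \<epsilon>) (- y h) < e"
    proof (rule eventually_at_rightI[OF _ d(1)], rule ballI)
      fix \<epsilon> h assume \<epsilon>: "\<epsilon> \<in> {0<..<d}" and h: "h \<in> ball h0 r"
      have \<epsilon>r: "\<epsilon> \<in> {0..r}" "\<epsilon> \<in> {0..1}" using \<epsilon> d r by auto
      note hK = rK[OF h]
      let ?\<beta> = "\<beta> h \<epsilon>"
      let ?R = "P (?\<beta> + S h) - P (S h) - P' (S h) ?\<beta>"
      let ?Q = "Q (?\<beta> + S h, \<epsilon>) - Q (S h, 0)"
      have bnd: "norm ?\<beta> \<le> M * \<epsilon>" by (rule \<beta>_le[OF hK \<epsilon>r(1)])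
      have "M * \<epsilon> < M * d" using \<epsilon> M by (intro mult_strict_left_mono) auto
      also have "\<dots> \<le> d1" using d(3) M by (simp add: field_simps)
      finally have "norm ?\<beta> < d1" using bnd by linarith
      from d1(2)[OF imageI[OF hK] this] have "norm ?R \<le> e1 * norm ?\<beta>" by (simp add: add.commute)
      also have "\<dots> \<le> e1 * (M * \<epsilon>)" using bnd e1 by (intro mult_left_mono) auto
      finally have R: "norm ?R \<le> e1 * (M * \<epsilon>)" .
      have "norm (Q (?\<beta> + S h, \<epsilon>) - Q (0 + S h, \<epsilon>)) \<le> L * norm (?\<beta> - 0)"
        by (rule LS[OF hK \<beta>(1)[OF hK \<epsilon>r(1)] _ \<epsilon>r(2)]) (use \<rho> in simp)
      also have "\<dots> \<le> L * (M * \<epsilon>)" using bnd L by (intro mult_left_mono) auto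
      also have "\<dots> \<le> L * (M * e1)" using \<epsilon> d(5) L M by (intro mult_left_mono) auto
      finally have Q1: "norm (Q (?\<beta> + S h, \<epsilon>) - Q (S h, \<epsilon>)) \<le> L * (M * e1)" by simp
      have "dist (Q (S h, \<epsilon>)) (Q (S h, 0)) < e1"
        using d2(2)[of "(h, 0)" "(h, \<epsilon>)"] hK \<epsilon>r \<epsilon> d(4) by (simp add: dist_Pair_Pair)
      then have "norm ?Q \<le> L * (M * e1) + e1"
        using Q1 norm_triangle_ineq[of "Q (?\<beta> + S h, \<epsilon>) - Q (S h, \<epsilon>)" "Q (S h, \<epsilon>) - Q (S h, 0)"]
        by (simp add: dist_norm)
      then have \<epsilon>Q: "norm (\<epsilon> *\<^sub>R ?Q) \<le> \<epsilon> * (L * (M * e1) + e1)" using \<epsilon> by simp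
      \<comment> \<open>Subtracting the equation solved by \<open>\<beta>\<close> from the
        linearised one cancels everything except the Taylor remainder and the change of
        \<open>Q\<close>; the constant term drops out because \<open>S h\<close> is a fixed point of
        \<open>P\<close>.\<close>
      have "\<epsilon> *\<^sub>R F' h 0 (?\<beta> /\<^sub>R \<epsilon> - - y h) = F' h 0 ?\<beta> + \<epsilon> *\<^sub>R \<pi>2 h (Q (S h, 0)) - F h \<epsilon> ?\<beta>"
        using \<epsilon> by (simp add: y[OF h] \<beta>(2)[OF hK \<epsilon>r(1)] blinfun.add_right blinfun.scaleR_right scaleR_add_right)
      also have "\<dots> = - \<pi>2 h (?R + \<epsilon> *\<^sub>R ?Q)"
        by (simp add: F'_def F_def fixed_points[OF K0[OF hK]] blinfun.add_left blinfun.diff_left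
            blinfun.add_right blinfun.diff_right blinfun.scaleR_right algebra_simps)
      finally have "norm (\<epsilon> *\<^sub>R F' h 0 (?\<beta> /\<^sub>R \<epsilon> - - y h)) \<le> N * norm (?R + \<epsilon> *\<^sub>R ?Q)"
        using N_app[OF hK] by simp
      also have "\<dots> \<le> N * (e1 * (M * \<epsilon>) + \<epsilon> * (L * (M * e1) + e1))"
        using N by (intro mult_left_mono norm_triangle_mono[OF R \<epsilon>Q]) auto
      also have "\<dots> = \<epsilon> * (N * ((M + L * M + 1) * e1))" by (simp add: algebra_simps)
      finally have "norm (F' h 0 (?\<beta> /\<^sub>R \<epsilon> - - y h)) \<le> N * ((M + L * M + 1) * e1)"
        using \<epsilon> by simp
      then have "2 * b * norm (F' h 0 (?\<beta> /\<^sub>R \<epsilon> - - y h)) \<le> 2 * b * (N * ((M + L * M + 1) * e1))"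
        using b by (intro mult_left_mono) auto
      also have "\<dots> = D * e1" by (simp add: D_def)
      also have "\<dots> = e / 2" using D by (simp add: e1_def)
      finally have "norm (?\<beta> /\<^sub>R \<epsilon> - - y h) \<le> e / 2"
        using F'_below[OF hK, of "?\<beta> /\<^sub>R \<epsilon> - - y h" 0] by (simp add: blinfun.zero_right)
      then show "dist (?\<beta> /\<^sub>R \<epsilon>) (- y h) < e" using e by (simp add: dist_norm)
    qed
  qed
  show thesis
  proof (rule that[of r M \<rho> \<beta>])
    show "\<beta> h \<epsilon> = x" if h: "h \<in> ball h0 r" and \<epsilon>: "\<epsilon> \<in> {0..r}" and x: "norm x \<le> \<rho>" "F h \<epsilon> x = 0" for h \<epsilon> x
      using stab[OF rK[OF h] \<epsilon> \<beta>(1)[OF rK[OF h] \<epsilon>], of x] x \<beta>(2)[OF rK[OF h] \<epsilon>] by simp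
  qed (use r M \<rho> F'_bij rK \<beta>_cont \<beta>_le \<beta>(2) limit in auto)
qed

end

section \<open>The map \<open>H\<close> and the passage between the two equations\<close>

theorem theorem2p1:
  fixes P :: "'e::banach \<Rightarrow> 'e"
    and P' :: "'e \<Rightarrow> 'e \<Rightarrow>\<^sub>L 'e"
    and Q :: "'e \<times> real \<Rightarrow> 'e"
    and h0 :: "real ^ 'k"
    and r0 :: real
    and S :: "real ^ 'k \<Rightarrow> 'e"
    and S' :: "real ^ 'k \<Rightarrow> (real ^ 'k) \<Rightarrow>\<^sub>L 'e"
    and E1 E2 :: "real ^ 'k \<Rightarrow> 'e set"
    and \<pi>1 \<pi>2 :: "real ^ 'k \<Rightarrow> 'e \<Rightarrow>\<^sub>L 'e"
    and \<xi>0 :: 'e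
  assumes P_deriv: "\<And>x. (P has_derivative blinfun_apply (P' x)) (at x)"
    and P'_cont: "continuous_on UNIV P'"
    and Q_cont: "continuous_on (UNIV \<times> {0..1}) Q"
    and Q_lipschitz: "\<And>R. R > 0 \<Longrightarrow> \<exists>L>0. \<forall>\<xi>1\<in>ball 0 R. \<forall>\<xi>2\<in>ball 0 R. \<forall>\<epsilon>\<in>{0..1}.
        norm (Q (\<xi>1, \<epsilon>) - Q (\<xi>2, \<epsilon>)) \<le> L * norm (\<xi>1 - \<xi>2)"
    and r0_pos: "r0 > 0"
    and S_deriv: "\<And>h. h \<in> ball h0 r0 \<Longrightarrow> (S has_derivative blinfun_apply (S' h)) (at h)"
    and S'_cont: "continuous_on (ball h0 r0) S'"
    and fixed_points: "\<And>\<xi>. \<xi> \<in> S ` ball h0 r0 \<Longrightarrow> P \<xi> = \<xi>"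
    and dim_S': "dim (range (blinfun_apply (S' h0))) = CARD('k)"
    and E1_eq: "\<And>h. h \<in> ball h0 r0 \<Longrightarrow> E1 h = range (blinfun_apply (S' h))"
    and E2_compl: "\<And>h. h \<in> ball h0 r0 \<Longrightarrow> direct_sum_decomp (E1 h) (E2 h)"
    and \<pi>1_proj: "\<And>h. h \<in> ball h0 r0 \<Longrightarrow> projector_onto_along (\<pi>1 h) (E1 h) (E2 h)"
    and \<pi>2_proj: "\<And>h. h \<in> ball h0 r0 \<Longrightarrow> projector_onto_along (\<pi>2 h) (E2 h) (E1 h)"
    and \<pi>1_cont: "continuous_on (ball h0 r0) \<pi>1"
    and \<pi>2_cont: "continuous_on (ball h0 r0) \<pi>2"
    and \<xi>0_eq: "\<xi>0 = S h0"
    and invertible: "invertible_on (\<pi>2 h0 o\<^sub>L (P' \<xi>0 - id_blinfun) o\<^sub>L \<pi>2 h0) (E2 h0)"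
  shows "\<exists>r1 r2 (H :: 'e \<Rightarrow> real ^ 'k) (\<beta> :: real ^ 'k \<Rightarrow> real \<Rightarrow> 'e).
      0 < r2 \<and> r2 < r1 \<and> r1 < r0 \<and> r1 \<le> 1 \<and>
      (\<forall>h\<in>ball h0 r1. inj (blinfun_apply (S' h)) \<and>
         invertible_on (\<pi>2 h o\<^sub>L (P' (S h) - id_blinfun) o\<^sub>L \<pi>2 h) (E2 h)) \<and>
      (H \<longlongrightarrow> h0) (at \<xi>0) \<and>
      (\<forall>\<epsilon>\<in>{0..r1}. continuous_on (ball h0 r1) (\<lambda>h. \<beta> h \<epsilon>)) \<and>
      (\<exists>M>0. \<forall>h\<in>ball h0 r1. \<forall>\<epsilon>\<in>{0..r1}. norm (\<beta> h \<epsilon>) \<le> M * \<epsilon>) \<and>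
      (\<forall>h\<in>ball h0 r1. \<forall>\<epsilon>\<in>{0..r1}. \<beta> h \<epsilon> \<in> E2 h) \<and>
      uniform_limit (ball h0 r1) (\<lambda>\<epsilon> h. \<beta> h \<epsilon> /\<^sub>R \<epsilon>)
        (\<lambda>h. - inverse_on (\<pi>2 h o\<^sub>L (P' (S h) - id_blinfun) o\<^sub>L \<pi>2 h) (E2 h)
                 (blinfun_apply (\<pi>2 h) (Q (S h, 0))))
        (at_right 0) \<and>
      (\<forall>\<xi>\<in>ball \<xi>0 r2. \<forall>\<epsilon>\<in>{0..r2}.
         P \<xi> - \<xi> + \<epsilon> *\<^sub>R Q (\<xi>, \<epsilon>) = 0 \<longrightarrow>
         H \<xi> \<in> ball h0 r1 \<and>
         inv (blinfun_apply (S' (H \<xi>))) (blinfun_apply (\<pi>1 (H \<xi>))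
           (P (\<beta> (H \<xi>) \<epsilon> + S (H \<xi>)) - (\<beta> (H \<xi>) \<epsilon> + S (H \<xi>))
             + \<epsilon> *\<^sub>R Q (\<beta> (H \<xi>) \<epsilon> + S (H \<xi>), \<epsilon>))) = 0) \<and>
      (\<forall>h\<in>ball h0 r1. \<forall>\<epsilon>\<in>{0..r1}.
         inv (blinfun_apply (S' h)) (blinfun_apply (\<pi>1 h)
           (P (\<beta> h \<epsilon> + S h) - (\<beta> h \<epsilon> + S h) + \<epsilon> *\<^sub>R Q (\<beta> h \<epsilon> + S h, \<epsilon>))) = 0 \<longrightarrow>
         P (\<beta> h \<epsilon> + S h) - (\<beta> h \<epsilon> + S h) + \<epsilon> *\<^sub>R Q (\<beta> h \<epsilon> + S h, \<epsilon>) = 0)"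
proof -
  have S'_inj: "inj (blinfun_apply (S' h0))"
    using dim_S' by (intro inj_if_dim_range_eq blinfun.bounded_linear_right[THEN bounded_linear.linear]) simp
  have P_S: "\<And>h. h \<in> ball h0 r0 \<Longrightarrow> P (S h) = S h"
    using fixed_points by blast
  have "fixed_point_manifold P P' Q h0 r0 S S' E1 E2 \<pi>1 \<pi>2"
  proof (rule fixed_point_manifold.intro)
    show "invertible_on (\<pi>2 h0 o\<^sub>L (P' (S h0) - id_blinfun) o\<^sub>L \<pi>2 h0) (E2 h0)"
      using invertible unfolding \<xi>0_eq .
  qed (fact P_deriv P'_cont Q_cont Q_lipschitz r0_pos S_deriv S'_cont P_S S'_inj E1_eq E2_compl
      \<pi>1_proj \<pi>2_proj \<pi>1_cont \<pi>2_cont)+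
  then interpret fixed_point_manifold P P' Q h0 r0 S S' E1 E2 \<pi>1 \<pi>2 .
  obtain q where q: "0 < q" "q \<le> r0" "\<And>h. h \<in> ball h0 q \<Longrightarrow> inj (S' h)"
    using S'_inj_near by blast
  obtain r M \<rho> \<beta> where r: "0 < r" "r < r0" "r \<le> 1" "r \<le> q" and M: "0 < M" and \<rho>: "0 < \<rho>"
    and bij: "\<And>h. h \<in> ball h0 r \<Longrightarrow> bij (F' h 0)"
    and \<beta>_cont: "\<And>\<epsilon>. \<epsilon> \<in> {0..r} \<Longrightarrow> continuous_on (ball h0 r) (\<lambda>h. \<beta> h \<epsilon>)"
    and \<beta>_le: "\<And>h \<epsilon>. h \<in> ball h0 r \<Longrightarrow> \<epsilon> \<in> {0..r} \<Longrightarrow> norm (\<beta> h \<epsilon>) \<le> M * \<epsilon>"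
    and \<beta>_zero: "\<And>h \<epsilon>. h \<in> ball h0 r \<Longrightarrow> \<epsilon> \<in> {0..r} \<Longrightarrow> F h \<epsilon> (\<beta> h \<epsilon>) = 0"
    and \<beta>_unique: "\<And>h \<epsilon> x. h \<in> ball h0 r \<Longrightarrow> \<epsilon> \<in> {0..r} \<Longrightarrow> norm x \<le> \<rho> \<Longrightarrow> F h \<epsilon> x = 0 \<Longrightarrow> \<beta> h \<epsilon> = x"
    and \<beta>_limit: "\<And>y. (\<And>h. h \<in> ball h0 r \<Longrightarrow> F' h 0 (y h) = \<pi>2 h (Q (S h, 0))) \<Longrightarrow>
      uniform_limit (ball h0 r) (\<lambda>\<epsilon> h. \<beta> h \<epsilon> /\<^sub>R \<epsilon>) (\<lambda>h. - y h) (at_right 0)"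
    by (rule small_zero_branch[OF q(1)]) (rule that; fast)
  have in0: "h \<in> ball h0 r0" if "h \<in> ball h0 r" for h using that r by simp
  have inj: "inj (S' h)" if "h \<in> ball h0 r" for h using that r q(3) by simp
  have inv_T: "invertible_on (T h) (E2 h)" if "h \<in> ball h0 r" for h
    using bij_F'_iff[OF in0[OF that]] bij[OF that] by blast
  \<comment> \<open>\<open>inv\<close> picks some preimage; injectivity is what forces 0 to be sent
    to 0.\<close>
  have inv_0: "inv (S' h) 0 = 0" if "h \<in> ball h0 r" for h
    by (rule inv_f_eq[OF inj[OF that]]) (rule blinfun.zero_right)

  obtain C s where C: "C > 0" and s: "s > 0"
    and ex: "\<And>\<xi>. norm (\<xi> - S h0) < s \<Longrightarrow>
      \<exists>h\<in>ball h0 r0. norm (h - h0) \<le> C * norm (\<xi> - S h0) \<and> \<pi>1 h (\<xi> - S h) = 0"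
  proof (rule continuous_projection_along_surface[OF r0_pos S_deriv[OF h0_in] S_cont S'_cont \<pi>1_cont S'_inj])
    show "\<pi>1 h x \<in> range (S' h)" if "h \<in> ball h0 r0" for h x
      using proj_in(1)[OF that] E1_eq[OF that] by simp
    show "\<pi>1 h0 (S' h0 v) = S' h0 v" for v
      by (rule proj_E1(1)[OF h0_in]) (simp add: E1_eq[OF h0_in])
  qed blast
  \<comment> \<open>\<open>H\<close> is a mere choice, arbitrary away from \<open>S h0\<close>. The
    linear bound alone gives its limit at \<open>\<xi>0\<close>.\<close>
  then obtain H where H: "\<And>\<xi>. norm (\<xi> - S h0) < s \<Longrightarrow>
      H \<xi> \<in> ball h0 r0 \<and> norm (H \<xi> - h0) \<le> C * norm (\<xi> - S h0) \<and> \<pi>1 (H \<xi>) (\<xi> - S (H \<xi>)) = 0"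
    by metis
  have H_lim: "(H \<longlongrightarrow> h0) (at \<xi>0)"
  proof (rule LIM_zero_cancel, rule Lim_null_comparison)
    show "\<forall>\<^sub>F \<xi> in at \<xi>0. norm (H \<xi> - h0) \<le> C * norm (\<xi> - S h0)"
      unfolding eventually_at using H s by (auto simp: \<xi>0_eq dist_norm)
    have "((\<lambda>\<xi>. C * norm (\<xi> - S h0)) \<longlongrightarrow> C * norm (\<xi>0 - S h0)) (at \<xi>0)"
      by (intro tendsto_intros)
    then show "((\<lambda>\<xi>. C * norm (\<xi> - S h0)) \<longlongrightarrow> 0) (at \<xi>0)" by (simp add: \<xi>0_eq)
  qed
  have "isCont S h0"
    using S_cont h0_in by (simp add: continuous_on_eq_continuous_at)
  then obtain d where d: "d > 0" "\<And>h. dist h h0 < d \<Longrightarrow> dist (S h) (S h0) < \<rho> / 2"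
    using \<rho> unfolding continuous_at_eps_delta by (meson half_gt_zero)
  \<comment> \<open>\<open>s\<close> makes the choice of \<open>H\<close> valid,
    \<open>r / 2\<close> makes \<open>r2\<close> strictly smaller than \<open>r\<close>,
    \<open>r / C\<close> puts \<open>H \<xi>\<close> in the ball of radius \<open>r\<close>, and
    \<open>\<rho> / 2\<close> with \<open>d / C\<close> bring \<open>\<xi> - S (H \<xi>)\<close>
    into the uniqueness ball.\<close>
  define r2 where "r2 = Min {s, r / 2, \<rho> / 2, r / C, d / C}"
  have "0 < r2" using s r \<rho> C d(1) by (simp add: r2_def)
  moreover have "r2 \<le> s" "r2 \<le> r / 2" "r2 \<le> \<rho> / 2" "r2 \<le> r / C" "r2 \<le> d / C"
    unfolding r2_def by (rule Min_le; simp)+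
  ultimately have r2: "0 < r2" "r2 \<le> s" "r2 < r" "r2 \<le> \<rho> / 2" "r2 \<le> r / C" "r2 \<le> d / C"
    using r(1) by auto
  \<comment> \<open>More than required: \<open>\<xi>\<close> is recovered exactly as
    \<open>\<beta> (H \<xi>) \<epsilon> + S (H \<xi>)\<close>. The choice of \<open>H\<close> kills
    the \<open>\<pi>1\<close> part of \<open>F\<close> and the equation kills the rest, so
    uniqueness applies.\<close>
  have part1: "H \<xi> \<in> ball h0 r \<and> \<beta> (H \<xi>) \<epsilon> = \<xi> - S (H \<xi>)"
    if \<xi>: "\<xi> \<in> ball \<xi>0 r2" and \<epsilon>: "\<epsilon> \<in> {0..r2}" and eq: "P \<xi> - \<xi> + \<epsilon> *\<^sub>R Q (\<xi>, \<epsilon>) = 0" for \<xi> \<epsilon>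
  proof -
    have n: "norm (\<xi> - S h0) < r2" using \<xi> by (simp add: \<xi>0_eq dist_norm norm_minus_commute)
    then have H\<xi>: "norm (H \<xi> - h0) \<le> C * norm (\<xi> - S h0)" "\<pi>1 (H \<xi>) (\<xi> - S (H \<xi>)) = 0"
      using H[of \<xi>] r2(2) by auto
    have "C * norm (\<xi> - S h0) < C * r2" using n C by simp
    moreover have "C * r2 \<le> r" "C * r2 \<le> d" using r2(5,6) C by (auto simp: field_simps)
    ultimately have "norm (H \<xi> - h0) < r" "norm (H \<xi> - h0) < d" using H\<xi>(1) by auto
    then have h: "H \<xi> \<in> ball h0 r" and "dist (S (H \<xi>)) (S h0) < \<rho> / 2"
      using d(2)[of "H \<xi>"] by (simp_all add: dist_norm norm_minus_commute[of h0])
    then have "norm (\<xi> - S (H \<xi>)) \<le> \<rho>"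
      using n r2(4) norm_triangle_ineq4[of "\<xi> - S h0" "S (H \<xi>) - S h0"] by (simp add: dist_norm)
    moreover have "F (H \<xi>) \<epsilon> (\<xi> - S (H \<xi>)) = 0"
      using H\<xi>(2) eq by (simp add: F_def blinfun.zero_right)
    ultimately show ?thesis using \<beta>_unique[OF h] h \<epsilon> r2(3) by simp
  qed
  have part2: "P (\<beta> h \<epsilon> + S h) - (\<beta> h \<epsilon> + S h) + \<epsilon> *\<^sub>R Q (\<beta> h \<epsilon> + S h, \<epsilon>) = 0"
    if h: "h \<in> ball h0 r" and \<epsilon>: "\<epsilon> \<in> {0..r}" and z: "inv (S' h) (\<pi>1 h
      (P (\<beta> h \<epsilon> + S h) - (\<beta> h \<epsilon> + S h) + \<epsilon> *\<^sub>R Q (\<beta> h \<epsilon> + S h, \<epsilon>))) = 0" for h \<epsilon>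
  proof -
    let ?v = "P (\<beta> h \<epsilon> + S h) - (\<beta> h \<epsilon> + S h) + \<epsilon> *\<^sub>R Q (\<beta> h \<epsilon> + S h, \<epsilon>)"
    have "\<pi>1 h ?v \<in> range (S' h)" using proj_in(1)[OF in0[OF h]] E1_eq[OF in0[OF h]] by simp
    \<comment> \<open>Membership in the range lets \<open>S' h\<close> undo \<open>inv\<close>, so
      the vanishing coordinates give a vanishing \<open>\<pi>1\<close> part; the
      \<open>\<pi>2\<close> part vanishes by construction of \<open>\<beta>\<close>.\<close>
    from f_inv_into_f[OF this] z have "\<pi>1 h ?v = 0" by (simp add: blinfun.zero_right)
    moreover have "\<pi>2 h ?v = 0" using \<beta>_zero[OF h \<epsilon>] F_zero_iff[OF in0[OF h]] by blast
    ultimately show ?thesis using proj_sum[OF in0[OF h], of ?v] by simp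
  qed
  show ?thesis
    unfolding T_def[symmetric]
  proof (rule exI[of _ r], rule exI[of _ r2], rule exI[of _ H], rule exI[of _ \<beta>], intro conjI ballI impI)
    show "\<exists>M>0. \<forall>h\<in>ball h0 r. \<forall>\<epsilon>\<in>{0..r}. norm (\<beta> h \<epsilon>) \<le> M * \<epsilon>"
      using M \<beta>_le by blast
    show "\<beta> h \<epsilon> \<in> E2 h" if "h \<in> ball h0 r" "\<epsilon> \<in> {0..r}" for h \<epsilon>
      using \<beta>_zero[OF that] F_zero_iff[OF in0[OF that(1)]] by blast
    show "uniform_limit (ball h0 r) (\<lambda>\<epsilon> h. \<beta> h \<epsilon> /\<^sub>R \<epsilon>)
        (\<lambda>h. - inverse_on (T h) (E2 h) (\<pi>2 h (Q (S h, 0)))) (at_right 0)"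
      by (intro \<beta>_limit inverse_on_T inv_T proj_in(2) in0)
    fix \<xi> \<epsilon> assume "\<xi> \<in> ball \<xi>0 r2" "\<epsilon> \<in> {0..r2}" and eq: "P \<xi> - \<xi> + \<epsilon> *\<^sub>R Q (\<xi>, \<epsilon>) = 0"
    note * = part1[OF this]
    then show "H \<xi> \<in> ball h0 r" by simp
    show "inv (S' (H \<xi>)) (\<pi>1 (H \<xi>)
        (P (\<beta> (H \<xi>) \<epsilon> + S (H \<xi>)) - (\<beta> (H \<xi>) \<epsilon> + S (H \<xi>))
          + \<epsilon> *\<^sub>R Q (\<beta> (H \<xi>) \<epsilon> + S (H \<xi>), \<epsilon>))) = 0"
      using * eq by (simp add: blinfun.zero_right inv_0)
  qed (fact r r2 inj inv_T H_lim \<beta>_cont part2)+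
qed

end
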